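(* Let $\ell$ be an odd prime, let $m\ge 0$ be an integer, and put $k=\ell m+(\ell-1)$. Let $q=e^{2\pi i\tau}$, $\zeta=e^{2\pi i z}$, and define $$C_{k,2}(z,\tau)=\prod_{n=1}^\infty\frac{(1+\zeta^{2}q^n)(1+\zeta^{-2}q^n)}{(1-q^n)^m\Big[\prod_{a\in\{1,3,5,\dots,\ell-2\}}(1-\zeta^{a}q^n)(1-\zeta^{-a}q^n)\Big]^{m+1}}.$$ Then $C_{k,2}$ is a crank generating function for $p_{k,2}(n)$, i.e. setting $\zeta=1$ gives $\sum_{n\ge0}p_{k,2}(n)q^n$, and it explains the congruences $p_{k,2}(\ell n+\delta)\equiv 0\pmod{\ell}$ for every integer $\delta$ such that $8\delta+1$ is a quadratic non-residue modulo $\ell$: for every such $\delta$ and every integer $n\ge 0$, the coefficient of $q^{\ell n+\delta}$ in $C_{k,2}(z,\tau)$ (a Laurent polynomial in $\zeta$ with integer coefficients) is divisible by the $\ell$-th cyclotomic polynomial $\Phi_\ell(\zeta)$ (equivalently, vanishes at $\zeta=e^{2\pi i/\ell}$); in particular $p_{k,2}(\ell n+\delta)\equiv 0\pmod{\ell}$.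
   Context: For nonnegative integers $k,j$, $p_{k,j}(n)$ denotes the number of $(k+j)$-colored partitions of $n$ in which $j$ of the colors have distinct parts, i.e. $\sum_{n\ge0}p_{k,j}(n)q^n=\prod_{n\ge1}\frac{(1+q^n)^j}{(1-q^n)^k}$. An integer $a$ is a quadratic non-residue modulo $\ell$ if $a$ is not congruent to any square $x^2$ (including $0$) modulo $\ell$. *)

theory Defs
  imports
    "HOL-Analysis.Analysis"
    "HOL-Number_Theory.Number_Theory"
    "HOL-Library.Multiset"
    "HOL-Library.Poly_Mapping"
begin

text \<open>
  A coloured partition of \<open>n\<close> is a multiset of coloured parts \<open>(s, c)\<close>, where \<open>s \<ge> 1\<close> is the size
  and \<open>c\<close> the colour. The colours are \<open>0, \<dots>, k + j - 1\<close>, and the parts of each of the last \<open>j\<close>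
  colours have to be distinct. The size \<open>n\<close> is an integer so that \<open>pkj k j n = 0\<close> for \<open>n < 0\<close>.
\<close>

definition coloured_partitions :: "nat \<Rightarrow> nat \<Rightarrow> int \<Rightarrow> (nat \<times> nat) multiset set" where
  "coloured_partitions k j n =
     {M. (\<forall>(s, c)\<in>set_mset M. 1 \<le> s \<and> c < k + j) \<and>
         (\<forall>s c. k \<le> c \<longrightarrow> count M (s, c) \<le> 1) \<and>
         int (\<Sum>\<^sub># (image_mset fst M)) = n}"

definition pkj :: "nat \<Rightarrow> nat \<Rightarrow> int \<Rightarrow> nat" where
  "pkj k j n = card (coloured_partitions k j n)"

text \<open>
  Laurent polynomials over the integers: the group ring of \<open>\<int>\<close> with coefficients in \<open>\<int>\<close>.
\<close>

type_synonym laurent = "int \<Rightarrow>\<^sub>0 int"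

definition laurent_eval :: "laurent \<Rightarrow> complex \<Rightarrow> complex" where
  "laurent_eval P x = (\<Sum>i\<in>Poly_Mapping.keys P. of_int (Poly_Mapping.lookup P i) * x powi i)"

definition laurent_of_poly :: "int poly \<Rightarrow> laurent" where
  "laurent_of_poly P = (\<Sum>i\<le>degree P. Poly_Mapping.single (int i) (poly.coeff P i))"

definition cyclotomic :: "nat \<Rightarrow> int poly" where
  "cyclotomic n = (THE P. map_poly complex_of_int P =
     (\<Prod>k\<in>{k\<in>{1..n}. coprime k n}. [:- cis (2 * pi * real k / real n), 1:]))"

definition e2pi :: "complex \<Rightarrow> complex" where
  "e2pi z = exp (2 * of_real pi * \<i> * z)"

text \<open>
  The function \<open>C\<^bsub>k,2\<^esub>(z, \<tau>)\<close> for \<open>k = l m + (l - 1)\<close>. The product index is shifted: the factor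
  at \<open>n\<close> is the one with \<open>q^(n+1)\<close>.
\<close>

definition crank_C :: "nat \<Rightarrow> nat \<Rightarrow> complex \<Rightarrow> complex \<Rightarrow> complex" where
  "crank_C l m z \<tau> =
     (let \<zeta> = e2pi z; q = e2pi \<tau> in
      prodinf (\<lambda>n. (1 + \<zeta> powi 2 * q ^ Suc n) * (1 + \<zeta> powi (-2) * q ^ Suc n) /
           ((1 - q ^ Suc n) ^ m *
            (\<Prod>a\<in>{a\<in>{1..l - 2}. odd a}.
               (1 - \<zeta> powi int a * q ^ Suc n) * (1 - \<zeta> powi (- int a) * q ^ Suc n)) ^ (m + 1))))"

text \<open>
  \<open>c N\<close> is the coefficient of \<open>q^N\<close> in \<open>C\<^bsub>k,2\<^esub>(z, \<tau>)\<close>, as a Laurent polynomial in \<open>\<zeta>\<close>. The condition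
  on \<open>z\<close> and \<open>\<tau>\<close> says that \<open>\<bar>q\<bar> < 1\<close> and \<open>\<bar>\<zeta>^a q\<bar> < 1\<close> for all exponents
  \<open>a \<in> {\<plusminus>1, \<plusminus>3, \<dots>, \<plusminus>(l-2)}\<close> of the denominator; this is where every factor
  \<open>1 / (1 - \<zeta>^a q^n)\<close> is a geometric series in \<open>q\<close>.
\<close>

definition is_q_expansion :: "nat \<Rightarrow> nat \<Rightarrow> (int \<Rightarrow> laurent) \<Rightarrow> bool" where
  "is_q_expansion l m c \<longleftrightarrow>
     (\<forall>N<0. c N = 0) \<and>
     (\<forall>z \<tau>. real (l - 2) * \<bar>Im z\<bar> < Im \<tau> \<longrightarrow>
        (\<lambda>n. laurent_eval (c (int n)) (e2pi z) * e2pi \<tau> ^ n) sums crank_C l m z \<tau>)"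

end

theory Submission
  imports Defs "HOL-Complex_Analysis.Complex_Analysis"
begin

text \<open>
  The coefficient of \<open>q^N\<close> in the crank function is the sum of \<open>\<zeta>^e(\<lambda>)\<close> over the coloured partitions
  \<open>\<lambda>\<close> of \<open>N\<close>, where each part contributes to \<open>e(\<lambda>)\<close> an exponent determined by its colour; at \<open>\<zeta> = 1\<close>
  this counts the partitions.

  For \<open>\<zeta>^l = 1 \<noteq> \<zeta>\<close> the exponents \<open>\<plusminus>1, \<plusminus>3, \<dots>, \<plusminus>(l - 2)\<close> and \<open>0\<close> represent all residue classes modulo
  \<open>l\<close>, so the crank function becomes the product of
  \<open>(1 - q^n) (1 + \<zeta>\<^sup>2 q^n) (1 + \<zeta>^(-2) q^n) / (1 - q^(l n))^(m + 1)\<close>. By Jacobi's triple product, up to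
  the nonzero factor \<open>1 + \<zeta>\<^sup>2\<close>, the numerators multiply to a series supported on the triangular numbers
  \<open>N = j (j + 1) / 2\<close>, for which \<open>8 N + 1 = (2 j + 1)\<^sup>2\<close>, and the denominators are series in \<open>q^l\<close>. Hence
  the coefficient of \<open>q^N\<close> vanishes if \<open>8 N + 1\<close> is a non-residue. This holds at all roots of the
  cyclotomic polynomial, which therefore divides the coefficient; its value at \<open>1\<close> is \<open>l\<close>.
\<close>

section \<open>Weighted generating functions of coloured partitions\<close>

text \<open>The ground set \<open>A\<close> is a parameter because the product formula is proved by
  adding one coloured part at a time. Elements of \<open>D\<close> may occur at most once;
  \<open>w\<close> gives the size of a part.\<close>

definition restricted_msets :: "'a set \<Rightarrow> 'a set \<Rightarrow> ('a \<Rightarrow> nat) \<Rightarrow> nat \<Rightarrow> 'a multiset set" where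
  "restricted_msets A D w n =
     {M. set_mset M \<subseteq> A \<and> (\<forall>x\<in>D. count M x \<le> 1) \<and> (\<Sum>y\<in>#M. w y) = n}"

lemma restricted_msets_empty: "restricted_msets {} D w n = (if n = 0 then {{#}} else {})"
  by (auto simp: restricted_msets_def)

text \<open>A multiset containing \<open>a\<close> is reduced by removing a single copy. If
  \<open>a\<close> is in \<open>D\<close>, no copy can remain; otherwise the rest may contain
  \<open>a\<close> again, so the same family recurs on the right with total
  \<open>n - w a\<close>.\<close>

lemma restricted_msets_insert:
  assumes "a \<notin> A"
  shows "restricted_msets (insert a A) D w n =
           restricted_msets A D w n \<union>
           (if w a \<le> n
            then add_mset a ` restricted_msets (if a \<in> D then A else insert a A) D w (n - w a)
            else {})"
proof (intro equalityI subsetI)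
  fix M assume M: "M \<in> restricted_msets (insert a A) D w n"
  show "M \<in> restricted_msets A D w n \<union>
           (if w a \<le> n
            then add_mset a ` restricted_msets (if a \<in> D then A else insert a A) D w (n - w a)
            else {})"
  proof (cases "a \<in># M")
    case False
    then show ?thesis
      using M by (auto simp: restricted_msets_def)
  next
    case True
    then obtain M' where M': "M = add_mset a M'"
      by (metis mset_add)
    have cnt: "count M' x \<le> 1" if "x \<in> D" for x
    proof -
      have "count M' x \<le> count M x"
        by (simp add: M')
      also have "\<dots> \<le> 1"
        using M that by (auto simp: restricted_msets_def)
      finally show ?thesis .
    qed
    moreover have "a \<notin># M'" if "a \<in> D"
    proof
      assume "a \<in># M'"
      then have "count M a \<ge> 2"
        by (simp add: M' Suc_le_eq count_greater_zero_iff)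
      then show False
        using M that by (auto simp: restricted_msets_def)
    qed
    ultimately have "M' \<in> restricted_msets (if a \<in> D then A else insert a A) D w (n - w a)"
      using M unfolding M' restricted_msets_def by auto
    moreover have "w a \<le> n"
      using M unfolding M' restricted_msets_def by auto
    ultimately show ?thesis
      unfolding M' by auto
  qed
next
  fix M assume M: "M \<in> restricted_msets A D w n \<union>
           (if w a \<le> n
            then add_mset a ` restricted_msets (if a \<in> D then A else insert a A) D w (n - w a)
            else {})"
  then consider "M \<in> restricted_msets A D w n"
    | M' where "M = add_mset a M'" "w a \<le> n"
        "M' \<in> restricted_msets (if a \<in> D then A else insert a A) D w (n - w a)"
    by (auto split: if_splits)
  then show "M \<in> restricted_msets (insert a A) D w n"
  proof cases
    case 1
    then show ?thesis
      by (auto simp: restricted_msets_def)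
  next
    case 2
    have "a \<notin># M'" if "a \<in> D"
      using 2 that assms by (auto simp: restricted_msets_def)
    then have "count (add_mset a M') x \<le> 1" if "x \<in> D" for x
      using 2 that by (auto simp: restricted_msets_def not_in_iff)
    then show ?thesis
      using 2 by (auto simp: restricted_msets_def split: if_splits)
  qed
qed

lemma finite_restricted_msets:
  assumes "finite A" "\<And>x. x \<in> A \<Longrightarrow> w x > 0"
  shows "finite (restricted_msets A D w n)"
  using assms
proof (induction A arbitrary: n rule: finite_induct)
  case (insert a A)
  have IH: "finite (restricted_msets A D w n)" for n
    using insert by simp
  show ?case
  proof (induction n rule: less_induct)
    case (less n)
    \<comment> \<open>Positivity of \<open>w a\<close> makes \<open>n - w a\<close> smaller than
      \<open>n\<close>, which justifies the inner induction.\<close>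
    have "finite (restricted_msets (insert a A) D w (n - w a))" if "w a \<le> n"
      using that insert.prems[of a] by (intro less) auto
    then show ?case
      using IH by (subst restricted_msets_insert) (use insert.hyps in auto)
  qed
qed (simp add: restricted_msets_empty)

definition restricted_gf ::
    "'a set \<Rightarrow> 'a set \<Rightarrow> ('a \<Rightarrow> nat) \<Rightarrow> ('a \<Rightarrow> 'b::field) \<Rightarrow> 'b fps" where
  "restricted_gf A D w u =
     Abs_fps (\<lambda>n. \<Sum>M\<in>restricted_msets A D w n. \<Prod>y\<in>#M. u y)"

lemma restricted_gf_insert:
  assumes "a \<notin> A" "finite A" "\<And>x. x \<in> insert a A \<Longrightarrow> w x > 0"
  shows "restricted_gf (insert a A) D w u =
           restricted_gf A D w u +
           fps_const (u a) * fps_X ^ w a * restricted_gf (if a \<in> D then A else insert a A) D w u"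
proof (rule fps_ext)
  fix n
  let ?B = "if a \<in> D then A else insert a A"
  let ?S = "\<lambda>R. \<Sum>M\<in>R. \<Prod>y\<in>#M. u y"
  have fin: "finite (restricted_msets A D w n)" "finite (restricted_msets ?B D w n)" for n
    using assms by (auto intro!: finite_restricted_msets)
  have "fps_nth (restricted_gf (insert a A) D w u) n = ?S (restricted_msets (insert a A) D w n)"
    by (simp add: restricted_gf_def)
  also have "\<dots> = ?S (restricted_msets A D w n) +
      ?S (if w a \<le> n then add_mset a ` restricted_msets ?B D w (n - w a) else {})"
  proof -
    have fin': "finite (if w a \<le> n then add_mset a ` restricted_msets ?B D w (n - w a) else {})"
      using fin by simp
    have notin: "a \<notin># M" if "M \<in> restricted_msets A D w n" for M
      using that assms(1) by (auto simp: restricted_msets_def)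
    have "restricted_msets A D w n \<inter>
        (if w a \<le> n then add_mset a ` restricted_msets ?B D w (n - w a) else {}) = {}"
      by (auto split: if_splits dest: notin)
    then show ?thesis
      using fin fin' by (subst restricted_msets_insert[OF assms(1)]) (rule sum.union_disjoint)
  qed
  also have "?S (if w a \<le> n then add_mset a ` restricted_msets ?B D w (n - w a) else {}) =
      (if w a \<le> n then u a * ?S (restricted_msets ?B D w (n - w a)) else 0)"
    by (simp add: sum.reindex inj_on_def sum_distrib_left)
  finally show "fps_nth (restricted_gf (insert a A) D w u) n =
      fps_nth (restricted_gf A D w u +
        fps_const (u a) * fps_X ^ w a * restricted_gf ?B D w u) n"
    by (auto simp: restricted_gf_def mult.assoc fps_X_power_mult_nth)
qed

lemma restricted_gf_eq_prod:
  assumes "finite A" "\<And>x. x \<in> A \<Longrightarrow> w x > 0"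
  shows "restricted_gf A D w u =
           (\<Prod>x\<in>A. if x \<in> D then 1 + fps_const (u x) * fps_X ^ w x
                   else inverse (1 - fps_const (u x) * fps_X ^ w x))"
  using assms
proof (induction A rule: finite_induct)
  case empty
  show ?case
    by (rule fps_ext) (simp add: restricted_gf_def restricted_msets_empty)
next
  case (insert a A)
  note rec = restricted_gf_insert[of a A w D u, OF insert.hyps(2,1) insert.prems]
  show ?case
  proof (cases "a \<in> D")
    case True
    then show ?thesis
      using insert rec by (simp add: algebra_simps)
  next
    case False
    let ?y = "fps_const (u a) * fps_X ^ w a :: 'b fps"
    have "fps_nth (1 - ?y) 0 \<noteq> 0"
      using insert.prems[of a] by simp
    then have inv: "inverse (1 - ?y) * (1 - ?y) = 1"
      by (rule inverse_mult_eq_1)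
    \<comment> \<open>For \<open>a\<close> outside \<open>D\<close> the recursion is an equation
      \<open>F = G + y * F\<close>. It is solved by dividing by \<open>1 - y\<close>, a unit because
      \<open>w a > 0\<close>.\<close>
    have "(1 - ?y) * restricted_gf (insert a A) D w u = restricted_gf A D w u"
      using rec False by (simp add: algebra_simps)
    then have "inverse (1 - ?y) * (1 - ?y) * restricted_gf (insert a A) D w u =
        inverse (1 - ?y) * restricted_gf A D w u"
      by (simp only: mult.assoc)
    then show ?thesis
      using insert inv False by simp
  qed
qed

text \<open>No part of a partition of \<open>n\<close> exceeds \<open>n\<close>, so cutting off the
  part sizes at \<open>N\<close> loses nothing and leaves a finite ground set.\<close>

lemma coloured_partitions_eq_restricted_msets:
  assumes "n \<le> N"
  shows "coloured_partitions k j (int n) =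
           restricted_msets ({1..N} \<times> {..<k + j}) {x. k \<le> snd x} fst n"
proof -
  have "s \<le> n" if "(s, c) \<in># M" "(\<Sum>y\<in>#M. fst y) = n" for s c :: nat and M
  proof -
    from that(1) obtain M' where "M = add_mset (s, c) M'"
      by (metis mset_add)
    then show ?thesis using that(2) by auto
  qed
  then show ?thesis
    using assms unfolding coloured_partitions_def restricted_msets_def
    by (intro Collect_cong) (fastforce simp del: of_nat_sum_mset)
qed

lemma coloured_partitions_negative:
  assumes "N < 0"
  shows "coloured_partitions k j N = {}"
  using assms unfolding coloured_partitions_def by (auto simp del: of_nat_sum_mset)


section \<open>A finite Jacobi triple product\<close>

text \<open>Gaussian binomial coefficients, defined by a Pascal rule rather than as quotients, so
  that they exist for every \<open>q\<close> in a commutative ring.\<close>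

fun qbinomial :: "'a::comm_ring_1 \<Rightarrow> nat \<Rightarrow> nat \<Rightarrow> 'a" where
  "qbinomial q n 0 = 1"
| "qbinomial q 0 (Suc k) = 0"
| "qbinomial q (Suc n) (Suc k) = qbinomial q n k + q ^ Suc k * qbinomial q n (Suc k)"

definition qfact :: "'a::comm_ring_1 \<Rightarrow> nat \<Rightarrow> 'a" where
  "qfact q n = (\<Prod>s=1..n. 1 - q ^ s)"

lemma qfact_0 [simp]: "qfact q 0 = 1"
  by (simp add: qfact_def)

lemma qfact_Suc [simp]: "qfact q (Suc n) = qfact q n * (1 - q ^ Suc n)"
  by (simp add: qfact_def)

lemma qbinomial_eq_0: "n < k \<Longrightarrow> qbinomial q n k = 0"
  by (induction q n k rule: qbinomial.induct) auto

text \<open>The quotient formula with denominators cleared. In the induction step the two Pascal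
  terms contribute \<open>1 - q^(k+1)\<close> and \<open>q^(k+1) * (1 - q^(n-k))\<close> times
  \<open>qfact q n\<close>, which add up to \<open>1 - q^(n+1)\<close> times it.\<close>

lemma qbinomial_mult_qfact:
  "k \<le> n \<Longrightarrow> qbinomial q n k * (qfact q k * qfact q (n - k)) = qfact q n"
proof (induction q n k rule: qbinomial.induct)
  case (3 q n k)
  have 1: "qbinomial q n k * (qfact q k * qfact q (n - k)) = qfact q n"
    using 3 by simp
  have 2: "qbinomial q n (Suc k) * (qfact q (Suc k) * qfact q (n - k)) = qfact q n * (1 - q ^ (n - k))"
  proof (cases "k = n")
    case True
    then show ?thesis by (simp add: qbinomial_eq_0)
  next
    case False
    then have "n - k = Suc (n - Suc k)" using 3 by simp
    then have "qfact q (n - k) = qfact q (n - Suc k) * (1 - q ^ (n - k))"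
      by (metis qfact_Suc)
    moreover have "qbinomial q n (Suc k) * (qfact q (Suc k) * qfact q (n - Suc k)) = qfact q n"
      using 3 False by simp
    ultimately show ?thesis
      by (metis mult.assoc)
  qed
  have pow: "q ^ Suc k * q ^ (n - k) = q ^ Suc n"
    unfolding power_add[symmetric] using 3 by simp
  have "qbinomial q (Suc n) (Suc k) * (qfact q (Suc k) * qfact q (Suc n - Suc k)) =
      (1 - q ^ Suc k) * (qbinomial q n k * (qfact q k * qfact q (n - k))) +
      q ^ Suc k * (qbinomial q n (Suc k) * (qfact q (Suc k) * qfact q (n - k)))"
    by (simp add: algebra_simps)
  also have "\<dots> = qfact q n * (1 - q ^ Suc k + q ^ Suc k - q ^ Suc k * q ^ (n - k))"
    unfolding 1 2 by (simp add: algebra_simps)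
  finally show ?case
    unfolding pow by simp
qed auto

text \<open>Triangular numbers indexed by all integers, with \<open>tri (- j - 1) = tri j\<close>;
  they are the exponents on both sides of the triple product.\<close>

definition tri :: "int \<Rightarrow> nat" where
  "tri j = nat (j * (j + 1) div 2)"

lemma of_nat_tri: "2 * int (tri j) = j * (j + 1)"
proof -
  have "0 \<le> j * (j + 1)"
    by (cases "j \<ge> 0") (auto simp: mult_nonneg_nonneg mult_nonpos_nonpos)
  moreover have "even (j * (j + 1))"
    by auto
  ultimately show ?thesis
    by (simp add: tri_def)
qed

lemma tri_step: "tri (int (Suc i) - int (Suc b)) + Suc i = tri (int (Suc i) - int b) + b"
proof -
  have "2 * int (tri (int (Suc i) - int (Suc b)) + Suc i) = 2 * int (tri (int (Suc i) - int b) + b)"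
    unfolding of_nat_add distrib_left of_nat_tri by (simp add: algebra_simps)
  then show ?thesis
    by (simp only: mult_cancel_left of_nat_eq_iff) simp
qed

lemma tri_Suc: "tri (int (Suc i)) = tri (int i) + Suc i"
proof -
  have "2 * int (tri (int (Suc i))) = 2 * int (tri (int i) + Suc i)"
    unfolding of_nat_add distrib_left of_nat_tri by (simp add: algebra_simps)
  then show ?thesis
    by (simp only: mult_cancel_left of_nat_eq_iff) simp
qed

lemma tri_0 [simp]: "tri 0 = 0"
  by (simp add: tri_def)

lemma qbinomial_theorem:
  "(\<Prod>s=1..a. 1 + x * q ^ s) = (\<Sum>i\<le>a. x ^ i * (q ^ tri (int i) * qbinomial q a i))"
proof (induction a arbitrary: x)
  case (Suc a)
  let ?f = "\<lambda>i. x ^ i * (q ^ (tri (int i) + i) * qbinomial q a i)"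
  \<comment> \<open>Splitting off the factor \<open>s = 1\<close> turns the rest into the same
    product with \<open>x * q\<close> for \<open>x\<close>; hence the induction with arbitrary
    \<open>x\<close>.\<close>
  have "(\<Prod>s=1..Suc a. 1 + x * q ^ s) = (1 + x * q) * (\<Prod>s=1..a. 1 + (x * q) * q ^ s)"
    by (subst prod.atLeast_Suc_atMost) (simp_all add: prod.atLeast_Suc_atMost_Suc_shift mult.assoc del: prod.cl_ivl_Suc)
  also have "\<dots> = (1 + x * q) * (\<Sum>i\<le>a. ?f i)"
    unfolding Suc.IH by (simp add: power_mult_distrib power_add mult_ac)
  \<comment> \<open>The added term \<open>i = Suc a\<close> is zero by
    \<open>qbinomial_eq_0\<close>; it lets the index shift pair \<open>Suc i\<close> with
    \<open>i\<close>.\<close>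
  also have "\<dots> = (\<Sum>i\<le>Suc a. ?f i) + x * q * (\<Sum>i\<le>a. ?f i)"
    by (simp add: qbinomial_eq_0 algebra_simps)
  also have "\<dots> = 1 + (\<Sum>i\<le>a. ?f (Suc i) + x * q * ?f i)"
    by (simp add: sum.atMost_Suc_shift sum.distrib sum_distrib_left del: sum.atMost_Suc)
  also have "\<dots> = (\<Sum>i\<le>Suc a. x ^ i * (q ^ tri (int i) * qbinomial q (Suc a) i))"
    by (simp add: sum.atMost_Suc_shift tri_Suc power_add algebra_simps del: sum.atMost_Suc of_nat_Suc)
  finally show ?case .
qed simp

text \<open>
  The factors \<open>1 + q^s / x\<close> of the triple product are multiplied by \<open>x\<close>, so that the identity makes
  sense in every commutative ring.
\<close>

lemma finite_jacobi_triple_product: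
  "(\<Prod>s=1..a. 1 + x * q ^ s) * (\<Prod>s<b. x + q ^ s) =
     (\<Sum>i\<le>a + b. x ^ i * (q ^ tri (int i - int b) * qbinomial q (a + b) i))"
proof (induction b)
  case 0
  show ?case using qbinomial_theorem[of x q a] by simp
next
  case (Suc b)
  define n where "n = a + b"
  let ?f = "\<lambda>i. x ^ i * (q ^ tri (int i - int b) * qbinomial q n i)"
  have "(\<Prod>s=1..a. 1 + x * q ^ s) * (\<Prod>s<Suc b. x + q ^ s) = (\<Sum>i\<le>n. ?f i) * (x + q ^ b)"
    unfolding n_def Suc.IH[symmetric] by (simp add: mult.assoc)
  also have "\<dots> = q ^ b * (\<Sum>i\<le>Suc n. ?f i) + x * (\<Sum>i\<le>n. ?f i)"
    by (simp add: qbinomial_eq_0 algebra_simps)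
  also have "\<dots> = q ^ b * q ^ tri (- int b) + (\<Sum>i\<le>n. q ^ b * ?f (Suc i) + x * ?f i)"
    by (simp add: sum.atMost_Suc_shift sum.distrib sum_distrib_left distrib_left del: sum.atMost_Suc)
  also have "q ^ b * q ^ tri (- int b) = q ^ tri (- int (Suc b))"
  proof -
    have "2 * int (b + tri (- int b)) = 2 * int (tri (- int (Suc b)))"
      unfolding of_nat_add distrib_left of_nat_tri by (simp add: algebra_simps)
    then have "b + tri (- int b) = tri (- int (Suc b))"
      by (simp only: mult_cancel_left of_nat_eq_iff) simp
    then show ?thesis by (simp flip: power_add)
  qed
  also have "(\<Sum>i\<le>n. q ^ b * ?f (Suc i) + x * ?f i) =
      (\<Sum>i\<le>n. x ^ Suc i * (q ^ tri (int (Suc i) - int (Suc b)) * qbinomial q (Suc n) (Suc i)))"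
  proof (intro sum.cong refl)
    fix i
    \<comment> \<open>Rewriting the exponents by \<open>tri_step\<close> gives both summands a
      common power of \<open>q\<close>, and the Pascal rule combines them.\<close>
    have shift: "q ^ b * q ^ tri (int (Suc i) - int b) = q ^ tri (int (Suc i) - int (Suc b)) * q ^ Suc i"
      by (metis add.commute power_add tri_step)
    have "q ^ b * ?f (Suc i) =
        x ^ Suc i * ((q ^ b * q ^ tri (int (Suc i) - int b)) * qbinomial q n (Suc i))"
      by (simp only: mult_ac)
    also have "\<dots> =
        x ^ Suc i * (q ^ tri (int (Suc i) - int (Suc b)) * (q ^ Suc i * qbinomial q n (Suc i)))"
      unfolding shift by (simp only: mult_ac)
    finally show "q ^ b * ?f (Suc i) + x * ?f i =
        x ^ Suc i * (q ^ tri (int (Suc i) - int (Suc b)) * qbinomial q (Suc n) (Suc i))"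
      by (simp add: distrib_left mult_ac)
  qed
  finally show ?case
    by (simp add: n_def sum.atMost_Suc_shift del: sum.atMost_Suc)
qed

text \<open>Every additional factor \<open>1 - q^s\<close> has \<open>s > m\<close> and is therefore
  1 modulo \<open>q^(m+1)\<close>.\<close>

lemma qfact_dvd:
  assumes "m \<le> n"
  shows "q ^ Suc m dvd qfact q n - qfact q m"
  using assms
proof (induction n rule: dec_induct)
  case (step n)
  have "q ^ Suc m dvd q ^ Suc n"
    using step by (intro le_imp_power_dvd) auto
  moreover have "qfact q (Suc n) - qfact q m = (qfact q n - qfact q m) - qfact q n * q ^ Suc n"
    by (simp add: algebra_simps)
  ultimately show ?case
    using step.IH by (simp only: dvd_diff dvd_mult)
qed simp

lemma is_unit_qfact_fps_X: "is_unit (qfact (fps_X :: 'a::field fps) n)"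
proof -
  have "fps_nth (qfact fps_X n) 0 = (1 :: 'a)"
    by (induction n) simp_all
  then show ?thesis by (simp add: fps_is_unit_iff)
qed

text \<open>
  The exponent works out because \<open>tri j\<close> with \<open>j = i - (M + 1)\<close> makes up for the precision
  \<open>min i (2M + 1 - i) + 1\<close> to which the factorials cancel.
\<close>

lemma qbinomial_stable:
  assumes "i \<le> 2 * M + 1"
  shows "fps_X ^ Suc M dvd
     fps_X ^ tri (int i - int (Suc M)) * qbinomial fps_X (2 * M + 1) i * qfact fps_X M -
     (fps_X :: 'a::field fps) ^ tri (int i - int (Suc M))"
proof -
  define t where "t = min i (2 * M + 1 - i)"
  let ?X = "fps_X :: 'a fps" and ?T = "tri (int i - int (Suc M))"
  let ?b = "qbinomial ?X (2 * M + 1) i" and ?m = "\<lambda>n. qfact ?X n - qfact ?X t"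
  have t: "t \<le> i" "t \<le> 2 * M + 1 - i" "t \<le> M" "t \<le> 2 * M + 1"
    using assms by (auto simp: t_def)
  \<comment> \<open>Modulo \<open>?X ^ Suc t\<close> all three factorials in
    \<open>qbinomial_mult_qfact\<close> may be replaced by \<open>qfact ?X t\<close>. Cancelling one
    copy of this unit shows that \<open>?b * qfact ?X t\<close> is congruent to 1.\<close>
  have "?X ^ Suc t dvd ?b * (?m i * qfact ?X (2 * M + 1 - i) + qfact ?X t * ?m (2 * M + 1 - i))
      - ?m (2 * M + 1)"
    using t by (intro dvd_diff dvd_mult dvd_add dvd_mult2 qfact_dvd)
  also have "?b * (?m i * qfact ?X (2 * M + 1 - i) + qfact ?X t * ?m (2 * M + 1 - i)) - ?m (2 * M + 1) =
      ?b * (qfact ?X i * qfact ?X (2 * M + 1 - i)) - qfact ?X (2 * M + 1) -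
      qfact ?X t * (?b * qfact ?X t - 1)"
    by (simp add: algebra_simps)
  also have "\<dots> = - (qfact ?X t * (?b * qfact ?X t - 1))"
    by (subst qbinomial_mult_qfact) (use assms in auto)
  finally have "?X ^ Suc t dvd ?b * qfact ?X t - 1"
    using is_unit_qfact_fps_X[of t] by (metis dvd_minus_iff dvd_mult_unit_iff')
  then have "?X ^ Suc t dvd (?b * qfact ?X t - 1) + ?b * ?m M"
    using t by (intro dvd_add dvd_mult qfact_dvd)
  then have "?X ^ ?T * ?X ^ Suc t dvd ?X ^ ?T * (?b * qfact ?X M - 1)"
    by (intro mult_dvd_mono) (simp_all add: algebra_simps)
  moreover have "Suc M \<le> ?T + Suc t"
  proof -
    \<comment> \<open>Once the triangular number is expanded, both cases below,
      \<open>i = M - u\<close> and \<open>i = M + 1 + u\<close>, reduce to this inequality.\<close>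
    have *: "int u \<le> int u * int u" for u
      by (cases u) auto
    have "2 * int (Suc M) \<le> 2 * int (?T + Suc t)"
    proof (cases "i \<le> M")
      case True
      then obtain u where "M = i + u"
        using le_Suc_ex by blast
      then show ?thesis
        using *[of u] unfolding of_nat_add distrib_left of_nat_tri by (simp add: t_def algebra_simps)
    next
      case False
      then obtain u where "i = Suc M + u"
        by (metis le_Suc_ex not_less_eq_eq)
      then show ?thesis
        using *[of u] assms unfolding of_nat_add distrib_left of_nat_tri by (simp add: t_def algebra_simps)
    qed
    then show ?thesis
      by (simp only: mult_le_cancel_left_pos of_nat_le_iff zero_less_numeral)
  qed
  ultimately show ?thesis
    by (metis (no_types, lifting) dvd_trans le_imp_power_dvd mult.assoc mult.right_neutral power_add right_diff_distrib)
qed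

text \<open>The finite triple product with \<open>a = M\<close> and \<open>b = M + 1\<close> is
  enough: by \<open>qbinomial_stable\<close> each of its terms, times \<open>qfact fps_X M\<close>,
  is modulo \<open>fps_X ^ Suc M\<close> a constant times a triangular power of
  \<open>fps_X\<close>.\<close>

lemma jacobi_coeff_eq_0:
  fixes x :: "'a::field"
  assumes "x \<noteq> 0" "x \<noteq> -1" "N \<le> M" "\<And>j. N \<noteq> tri j"
  shows "fps_nth (\<Prod>s=1..M. (1 - fps_X ^ s) * (1 + fps_const x * fps_X ^ s) *
           (1 + fps_const (inverse x) * fps_X ^ s)) N = 0"
proof -
  let ?x = "fps_const x" and ?X = "fps_X :: 'a fps"
  let ?D = "\<Prod>s=1..M. (1 - ?X ^ s) * (1 + ?x * ?X ^ s) * (1 + fps_const (inverse x) * ?X ^ s)"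
  have "?x + ?X ^ s = ?x * (1 + fps_const (inverse x) * ?X ^ s)" for s
    using assms(1) by (simp add: distrib_left mult.assoc[symmetric])
  then have "(\<Prod>s=1..M. ?x + ?X ^ s) = (\<Prod>s=1..M. ?x * (1 + fps_const (inverse x) * ?X ^ s))"
    by (intro prod.cong refl)
  also have "\<dots> = ?x ^ M * (\<Prod>s=1..M. 1 + fps_const (inverse x) * ?X ^ s)"
    by (simp add: prod.distrib)
  finally have "(\<Prod>s=1..M. ?x + ?X ^ s) = \<dots>" .
  \<comment> \<open>The factor \<open>s = 0\<close> is \<open>x + 1\<close>; it is nonzero and can
    be divided out in the end.\<close>
  moreover have "(\<Prod>s<Suc M. ?x + ?X ^ s) = (?x + 1) * (\<Prod>s=1..M. ?x + ?X ^ s)"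
    by (simp add: prod.lessThan_Suc_shift prod.atLeast1_atMost_eq del: prod.lessThan_Suc)
  ultimately have "(?x + 1) * ?x ^ M * ?D =
      qfact ?X M * ((\<Prod>s=1..M. 1 + ?x * ?X ^ s) * (\<Prod>s<Suc M. ?x + ?X ^ s))"
    by (simp add: prod.distrib qfact_def mult_ac)
  also have "\<dots> = (\<Sum>i\<le>2 * M + 1. ?x ^ i *
      (?X ^ tri (int i - int (Suc M)) * qbinomial ?X (2 * M + 1) i * qfact ?X M))"
  proof -
    have n: "M + Suc M = 2 * M + 1"
      by simp
    show ?thesis
      unfolding finite_jacobi_triple_product sum_distrib_left n
      by (intro sum.cong refl) (simp only: mult_ac)
  qed
  finally have eq: "(?x + 1) * ?x ^ M * ?D = \<dots>" .
  have "fps_nth (?x ^ i * (?X ^ tri (int i - int (Suc M)) * qbinomial ?X (2 * M + 1) i * qfact ?X M)) N = 0"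
    if "i \<le> 2 * M + 1" for i
  proof -
    from qbinomial_stable[OF that] obtain g where
      "?X ^ tri (int i - int (Suc M)) * qbinomial ?X (2 * M + 1) i * qfact ?X M =
        ?X ^ tri (int i - int (Suc M)) + ?X ^ Suc M * g"
      by (metis (no_types, lifting) add.commute diff_add_cancel dvdE)
    then have "fps_nth (?X ^ tri (int i - int (Suc M)) * qbinomial ?X (2 * M + 1) i * qfact ?X M) N = 0"
      using assms(3,4) by (simp add: fps_X_power_mult_nth del: power_Suc)
    then show ?thesis
      by (simp add: fps_const_power)
  qed
  then have zero: "fps_nth ((?x + 1) * ?x ^ M * ?D) N = 0"
    unfolding eq fps_sum_nth by (intro sum.neutral) auto
  have const: "(?x + 1) * ?x ^ M = fps_const ((x + 1) * x ^ M)"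
    by (simp add: fps_const_power flip: fps_const_add fps_const_mult)
  have "(x + 1) * x ^ M * fps_nth ?D N = 0"
    using zero unfolding const fps_mult_left_const_nth .
  moreover have "x + 1 \<noteq> 0"
    using assms(2) by (simp add: add_eq_0_iff2)
  ultimately show ?thesis
    using assms(1) by (simp only: mult_eq_0_iff) simp
qed


section \<open>Laurent polynomials and cyclotomic divisibility\<close>

lemma laurent_eval_superset:
  assumes "finite A" "Poly_Mapping.keys P \<subseteq> A"
  shows "laurent_eval P x = (\<Sum>i\<in>A. of_int (Poly_Mapping.lookup P i) * x powi i)"
  unfolding laurent_eval_def using assms
  by (intro sum.mono_neutral_left) (auto simp: in_keys_iff)

lemma laurent_eval_0 [simp]: "laurent_eval 0 x = 0"
  by (simp add: laurent_eval_def)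

lemma laurent_eval_add: "laurent_eval (P + Q) x = laurent_eval P x + laurent_eval Q x"
proof -
  let ?A = "Poly_Mapping.keys P \<union> Poly_Mapping.keys Q"
  have "Poly_Mapping.keys (P + Q) \<subseteq> ?A"
    by (rule Poly_Mapping.keys_add)
  then show ?thesis
    by (simp add: laurent_eval_superset[of ?A] lookup_add distrib_right sum.distrib)
qed

lemma laurent_eval_diff: "laurent_eval (P - Q) x = laurent_eval P x - laurent_eval Q x"
  using laurent_eval_add[of "P - Q" Q x] by simp

lemma laurent_eval_sum: "laurent_eval (sum f A) x = (\<Sum>i\<in>A. laurent_eval (f i) x)"
  by (induction A rule: infinite_finite_induct) (simp_all add: laurent_eval_add)

lemma laurent_eval_single [simp]:
  "laurent_eval (Poly_Mapping.single i a) x = of_int a * x powi i"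
  by (subst laurent_eval_superset[of "{i}"]) auto

lemma laurent_eq_sum_singles:
  "(P :: laurent) =
     (\<Sum>i\<in>Poly_Mapping.keys P. Poly_Mapping.single i (Poly_Mapping.lookup P i))"
  by (rule poly_mapping_eqI) (simp add: lookup_sum lookup_single when_def in_keys_iff)

lemma laurent_eval_mult:
  assumes "x \<noteq> 0"
  shows "laurent_eval (P * Q) x = laurent_eval P x * laurent_eval Q x"
proof -
  let ?s = "\<lambda>R i. Poly_Mapping.single i (Poly_Mapping.lookup R i) :: laurent"
  have "P * Q = (\<Sum>i\<in>Poly_Mapping.keys P. ?s P i) * (\<Sum>j\<in>Poly_Mapping.keys Q. ?s Q j)"
    by (simp flip: laurent_eq_sum_singles)
  then have "laurent_eval (P * Q) x =
      (\<Sum>i\<in>Poly_Mapping.keys P. \<Sum>j\<in>Poly_Mapping.keys Q. laurent_eval (?s P i * ?s Q j) x)"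
    by (simp add: sum_product laurent_eval_sum)
  also have "\<dots> = laurent_eval P x * laurent_eval Q x"
    unfolding laurent_eval_def[of P] laurent_eval_def[of Q] sum_product
    using assms by (simp add: mult_single power_int_add mult_ac)
  finally show ?thesis .
qed

lemma laurent_eval_1_in_Ints: "laurent_eval P 1 \<in> \<int>"
  by (auto simp: laurent_eval_def intro: Ints_sum)

lemma laurent_of_poly_eq_sum:
  assumes "degree p \<le> n"
  shows "laurent_of_poly p = (\<Sum>i\<le>n. Poly_Mapping.single (int i) (poly.coeff p i))"
  unfolding laurent_of_poly_def using assms
  by (intro sum.mono_neutral_left) (auto simp: coeff_eq_0)

lemma laurent_of_poly_0 [simp]: "laurent_of_poly 0 = 0"
  by (simp add: laurent_of_poly_def)

lemma laurent_of_poly_add: "laurent_of_poly (p + q) = laurent_of_poly p + laurent_of_poly q"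
proof -
  let ?n = "max (degree p) (degree q)"
  have "degree (p + q) \<le> ?n"
    by (rule degree_add_le_max)
  then show ?thesis
    by (simp add: laurent_of_poly_eq_sum[of _ ?n] single_add sum.distrib)
qed

lemma laurent_of_poly_sum: "laurent_of_poly (sum f A) = (\<Sum>i\<in>A. laurent_of_poly (f i))"
  by (induction A rule: infinite_finite_induct) (simp_all add: laurent_of_poly_add)

lemma laurent_of_poly_smult:
  "laurent_of_poly (Polynomial.smult a p) = Poly_Mapping.single 0 a * laurent_of_poly p"
  by (simp add: laurent_of_poly_eq_sum[of _ "degree p"] degree_smult_le sum_distrib_left mult_single)

lemma laurent_of_poly_pCons:
  "laurent_of_poly (pCons a p) =
     Poly_Mapping.single 0 a + Poly_Mapping.single 1 1 * laurent_of_poly p"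
  by (simp add: laurent_of_poly_eq_sum[of "pCons a p" "Suc (degree p)"] degree_pCons_le
      laurent_of_poly_eq_sum[of p "degree p"] sum.atMost_Suc_shift sum_distrib_left mult_single
      add.commute del: sum.atMost_Suc)

lemma laurent_of_poly_mult: "laurent_of_poly (p * q) = laurent_of_poly p * laurent_of_poly q"
  by (induction p)
     (simp_all add: laurent_of_poly_add laurent_of_poly_pCons laurent_of_poly_smult algebra_simps)

lemma laurent_of_poly_monom: "laurent_of_poly (Polynomial.monom a n) = Poly_Mapping.single (int n) a"
proof -
  have "laurent_of_poly (Polynomial.monom a n) =
      (\<Sum>i\<le>n. if i = n then Poly_Mapping.single (int i) a else 0)"
    unfolding laurent_of_poly_eq_sum[OF degree_monom_le] by (intro sum.cong) auto
  then show ?thesis by simp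
qed

lemma laurent_eval_of_poly:
  assumes "x \<noteq> 0"
  shows "laurent_eval (laurent_of_poly p) x = poly (map_poly of_int p) x"
  by (induction p)
     (use assms in \<open>simp_all add: laurent_of_poly_pCons laurent_eval_add laurent_eval_mult map_poly_pCons\<close>)

lemma laurent_eq_shift_poly:
  obtains d p where "P = Poly_Mapping.single (- int d) 1 * laurent_of_poly p"
proof -
  \<comment> \<open>Shifting by \<open>d\<close> makes all exponents nonnegative;
    \<open>insert 0\<close> covers \<open>P = 0\<close>, where the maximum would range over the
    empty set.\<close>
  define d where "d = Max (insert 0 ((\<lambda>i. nat \<bar>i\<bar>) ` Poly_Mapping.keys P))"
  define p where
    "p = (\<Sum>i\<in>Poly_Mapping.keys P. Polynomial.monom (Poly_Mapping.lookup P i) (nat (i + int d)))"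
  have "int (nat (i + int d)) = i + int d" if "i \<in> Poly_Mapping.keys P" for i
  proof -
    have "nat \<bar>i\<bar> \<le> d"
      unfolding d_def using that by (intro Max_ge) auto
    then show ?thesis by linarith
  qed
  then have "laurent_of_poly p =
      (\<Sum>i\<in>Poly_Mapping.keys P. Poly_Mapping.single (i + int d) (Poly_Mapping.lookup P i))"
    unfolding p_def laurent_of_poly_sum laurent_of_poly_monom
    by simp
  then have "Poly_Mapping.single (- int d) 1 * laurent_of_poly p =
      (\<Sum>i\<in>Poly_Mapping.keys P. Poly_Mapping.single i (Poly_Mapping.lookup P i))"
    by (simp add: sum_distrib_left mult_single)
  then show ?thesis
    using that laurent_eq_sum_singles by metis
qed

text \<open>Up to a power of the variable, \<open>P - Q\<close> is a polynomial, and a polynomial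
  with infinitely many zeros is zero.\<close>

lemma laurent_eqI:
  assumes "\<And>x. x \<noteq> 0 \<Longrightarrow> laurent_eval P x = laurent_eval Q x"
  shows "P = Q"
proof -
  obtain d p where p: "P - Q = Poly_Mapping.single (- int d) 1 * laurent_of_poly p"
    by (rule laurent_eq_shift_poly)
  have "poly (map_poly of_int p) x = (0 :: complex)" if "x \<noteq> 0" for x
  proof -
    have "laurent_eval (P - Q) x = 0"
      using assms[OF that] by (simp add: laurent_eval_diff)
    then show ?thesis
      using that unfolding p by (simp add: laurent_eval_mult laurent_eval_of_poly)
  qed
  then have "UNIV - {0} \<subseteq> {x. poly (map_poly of_int p) x = (0 :: complex)}"
    by auto
  moreover have "infinite (UNIV - {0 :: complex})"
    by (simp add: infinite_UNIV_char_0)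
  ultimately have "map_poly of_int p = (0 :: complex poly)"
    using poly_roots_finite finite_subset by blast
  then have "p = 0"
    by (metis coeff_0 coeff_map_poly of_int_0 of_int_eq_0_iff poly_eqI)
  then show ?thesis
    using p by simp
qed

section \<open>Roots of unity and the cyclotomic polynomial of prime index\<close>

lemma prod_roots_of_unity:
  assumes "l > 0"
  shows "(\<Prod>z\<in>{z::complex. z ^ l = 1}. [:- z, 1:]) = Polynomial.monom 1 l - 1"
    and "(\<Prod>z\<in>{z::complex. z ^ l = 1}. [:1, - z:]) = 1 - Polynomial.monom 1 l"
proof -
  let ?S = "{z::complex. z ^ l = 1}"
  have fin: "finite ?S" and card: "card ?S = l"
    using assms finite_roots_unity[of l] card_roots_unity_eq[of l] by auto
  have deg: "degree (\<Prod>z\<in>?S. f z) \<le> l" if "\<And>z. degree (f z) \<le> 1" for f :: "complex \<Rightarrow> complex poly"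
  proof -
    have "degree (\<Prod>z\<in>?S. f z) \<le> (\<Sum>z\<in>?S. degree (f z))"
      using degree_prod_sum_le[OF fin, of f] by (simp add: o_def)
    also have "\<dots> \<le> (\<Sum>z\<in>?S. 1)"
      by (intro sum_mono that)
    finally show ?thesis
      by (simp add: card)
  qed
  have lin: "degree [:1, - z:] \<le> 1" for z :: complex
    by (cases "z = 0") auto
  have deg': "degree (Polynomial.monom (1 :: complex) l - 1) \<le> l" "degree (1 - Polynomial.monom (1 :: complex) l) \<le> l"
    by (intro degree_diff_le; simp add: degree_monom_le)+
  have lead: "lead_coeff (\<Prod>z\<in>?S. [:- z, 1:]) = 1"
    by (simp add: lead_coeff_prod)
  have dprod: "degree (\<Prod>z\<in>?S. [:- z, 1:]) = l"
    by (subst degree_prod_eq_sum_degree) (auto simp: card)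
  \<comment> \<open>Both sides are monic of degree \<open>l\<close>, so agreement at the
    \<open>l\<close> roots suffices.\<close>
  show "(\<Prod>z\<in>?S. [:- z, 1:]) = Polynomial.monom 1 l - 1"
  proof (rule poly_eqI_degree_lead_coeff[where n = l and A = ?S])
    show "poly.coeff (\<Prod>z\<in>?S. [:- z, 1:]) l = poly.coeff (Polynomial.monom 1 l - 1) l"
      using lead dprod assms by simp
  next
    fix w assume "w \<in> ?S"
    then show "poly (\<Prod>z\<in>?S. [:- z, 1:]) w = poly (Polynomial.monom 1 l - 1) w"
      using fin by (auto simp: poly_prod poly_monom prod_zero_iff)
  qed (use card deg deg' in auto)
  \<comment> \<open>Here the leading coefficients are not compared, so agreement at one more point
    is used, namely at 0.\<close>
  show "(\<Prod>z\<in>?S. [:1, - z:]) = 1 - Polynomial.monom 1 l"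
  proof (rule poly_eqI_degree[where A = "insert 0 ?S"])
    fix w assume "w \<in> insert 0 ?S"
    then consider "w = 0" | "w \<noteq> 0" "w \<in> ?S" using assms by auto
    then show "poly (\<Prod>z\<in>?S. [:1, - z:]) w = poly (1 - Polynomial.monom 1 l) w"
    proof cases
      case 1
      then show ?thesis using assms by (simp add: poly_prod poly_monom)
    next
      case 2
      then have "inverse w \<in> ?S"
        by (simp add: power_inverse)
      moreover have "1 - w * inverse w = 0"
        using 2 by simp
      ultimately have "(\<Prod>z\<in>?S. 1 - w * z) = 0"
        using fin by (intro prod_zero) blast+
      then show ?thesis
        using 2 by (simp add: poly_prod poly_monom)
    qed
  next
    have "card (insert 0 ?S) = Suc l"
      using fin card assms by (subst card_insert_disjoint) (auto simp: power_0_left)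
    then show "degree (\<Prod>z\<in>?S. [:1, - z:]) < card (insert 0 ?S)"
      "degree (1 - Polynomial.monom (1::complex) l) < card (insert 0 ?S)"
      using deg[of "\<lambda>z. [:1, - z:]", OF lin] deg' by (simp_all add: less_Suc_eq_le)
  qed
qed

lemma map_poly_of_int_sum_monom:
  "map_poly of_int (\<Sum>i<l. Polynomial.monom 1 i) = (\<Sum>i<l. Polynomial.monom (1 :: complex) i)"
  by (rule poly_eqI) (simp add: coeff_map_poly coeff_sum)

lemma cyclotomic_prime:
  assumes "prime l"
  shows "cyclotomic l = (\<Sum>i<l. Polynomial.monom 1 i)"
proof -
  let ?c = "\<lambda>k. cis (2 * pi * real k / real l)" and ?Q = "\<Sum>i<l. Polynomial.monom (1 :: int) i"
  have l: "l > 1"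
    using assms prime_gt_1_nat by blast
  have K: "{k \<in> {1..l}. coprime k l} = {1..<l}"
    using assms l by (auto simp: coprime_commute prime_nat_iff'' order_le_less intro: prime_imp_coprime dest: nat_dvd_not_less)
  have "(\<Prod>k<l. [:- ?c k, 1:]) = (\<Prod>z\<in>{z. z ^ l = 1}. [:- z, 1:])"
    using prod.reindex_bij_betw[OF Complex.bij_betw_roots_unity[of l], of "\<lambda>z. [:- z, 1:]"] l by simp
  also have "\<dots> = Polynomial.monom 1 l - 1"
    using l by (intro prod_roots_of_unity) auto
  also have "\<dots> = [:-1, 1:] * (\<Sum>i<l. Polynomial.monom 1 i)"
  proof (rule poly_eqI)
    fix n
    have "[:-1, 1:] * (\<Sum>i<l. Polynomial.monom (1 :: complex) i) = (\<Sum>i<l. Polynomial.monom 1 (Suc i) - Polynomial.monom 1 i)"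
      by (simp add: sum_distrib_left monom_Suc sum_subtractf)
    also have "\<dots> = Polynomial.monom 1 l - 1"
      by (subst sum_lessThan_telescope) simp
    finally show "poly.coeff (Polynomial.monom 1 l - 1) n = poly.coeff ([:-1, 1:] * (\<Sum>i<l. Polynomial.monom (1 :: complex) i)) n"
      by simp
  qed
  \<comment> \<open>The factor for \<open>k = 0\<close> belongs to the root 1; it is split off here
    and then cancelled on both sides.\<close>
  finally have "[:-1, 1:] * (\<Prod>k\<in>{1..<l}. [:- ?c k, 1:]) = [:-1, 1:] * (\<Sum>i<l. Polynomial.monom 1 i)"
    using l by (simp add: prod.atLeast_Suc_lessThan lessThan_atLeast0)
  then have prod: "(\<Prod>k\<in>{1..<l}. [:- ?c k, 1:]) = map_poly complex_of_int ?Q"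
    unfolding map_poly_of_int_sum_monom by (simp only: mult_cancel_left) simp
  show ?thesis
    unfolding cyclotomic_def K prod
  proof (rule the_equality)
    fix P assume "map_poly complex_of_int P = map_poly complex_of_int ?Q"
    then show "P = ?Q"
      by (metis (no_types, lifting) coeff_map_poly of_int_0 of_int_eq_iff poly_eqI)
  qed simp
qed

text \<open>By Bezout, an exponent \<open>i\<close> prime to \<open>l\<close> would make
  \<open>w\<close> a product of powers of \<open>w powi i\<close> and \<open>w ^ l\<close>, hence
  equal to 1.\<close>

lemma root_of_unity_powi_eq_1D:
  fixes w :: complex
  assumes "prime l" "w ^ l = 1" "w \<noteq> 1" "w powi i = 1"
  shows "int l dvd i"
proof (rule ccontr)
  assume "\<not> int l dvd i"
  moreover have "prime (int l)"
    using assms(1) by simp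
  ultimately have "gcd i (int l) = 1"
    using prime_imp_coprime[of "int l" i] by (simp add: coprime_iff_gcd_eq_1 gcd.commute)
  then obtain u v where uv: "u * i + v * int l = 1"
    using bezout_int[of i "int l"] by auto
  have [simp]: "w \<noteq> 0"
    using assms(1,2) prime_gt_0_nat[of l] by (auto simp: power_0_left)
  have "w = w powi (u * i + v * int l)"
    unfolding uv by simp
  also have "\<dots> = w powi (i * u) * w powi (int l * v)"
    by (simp add: power_int_add mult.commute)
  also have "\<dots> = 1"
    unfolding power_int_mult using assms by simp
  finally show False
    using assms(3) by simp
qed

lemma root_of_unity_powi_eq_iff:
  fixes w :: complex
  assumes "prime l" "w ^ l = 1" "w \<noteq> 1"
  shows "w powi i = w powi j \<longleftrightarrow> int l dvd i - j"
proof -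
  have [simp]: "w \<noteq> 0"
    using assms(1,2) prime_gt_0_nat[of l] by (auto simp: power_0_left)
  have "w powi i = w powi j \<longleftrightarrow> w powi (i - j) = 1"
    by (simp add: power_int_diff)
  also have "\<dots> \<longleftrightarrow> int l dvd i - j"
  proof
    assume "int l dvd i - j"
    then obtain u where "i - j = int l * u" ..
    then show "w powi (i - j) = 1"
      using assms(2) by (simp add: power_int_mult)
  qed (use root_of_unity_powi_eq_1D assms in blast)
  finally show ?thesis .
qed

text \<open>
  Irreducibility of the cyclotomic polynomial is not needed: as all its roots are zeros of \<open>P\<close>,
  the remainder of the division by it has more zeros than its degree allows.
\<close>

lemma cyclotomic_dvd_laurent:
  assumes l: "prime l" and zero: "\<And>w. w ^ l = 1 \<Longrightarrow> w \<noteq> 1 \<Longrightarrow> laurent_eval P w = 0"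
  shows "laurent_of_poly (cyclotomic l) dvd P"
proof -
  obtain d p where P: "P = Poly_Mapping.single (- int d) 1 * laurent_of_poly p"
    by (rule laurent_eq_shift_poly)
  let ?C = "cyclotomic l"
  let ?S = "{w :: complex. w ^ l = 1} - {1}"
  have l1: "l > 1"
    using l prime_gt_1_nat by blast
  have coeff: "poly.coeff ?C i = (if i < l then 1 else 0)" for i
    by (simp add: cyclotomic_prime[OF l] coeff_sum)
  have deg: "degree ?C = l - 1"
  proof (rule antisym)
    show "degree ?C \<le> l - 1"
      by (rule degree_le) (auto simp: coeff)
    show "l - 1 \<le> degree ?C"
      using l1 by (intro le_degree) (simp add: coeff)
  qed
  have monic: "lead_coeff ?C = 1"
    using l1 by (simp add: deg coeff)
  then have nz: "?C \<noteq> 0"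
    by force
  \<comment> \<open>As the cyclotomic polynomial is monic, pseudo-division is a genuine division
    with remainder over the integers.\<close>
  obtain q r where qr: "pseudo_divmod p ?C = (q, r)"
    by fastforce
  have eq: "p = ?C * q + r" and r: "r = 0 \<or> degree r < l - 1"
    using pseudo_divmod[OF nz qr] monic by (simp_all add: deg)
  have "poly (map_poly of_int r) w = 0" if "w \<in> ?S" for w
  proof -
    have w: "w ^ l = 1" "w \<noteq> 1" "w \<noteq> 0"
      using that l1 by (auto simp: power_0_left)
    have "poly (map_poly of_int ?C) w = (\<Sum>i<l. w ^ i)"
      by (simp add: cyclotomic_prime[OF l] map_poly_of_int_sum_monom poly_sum poly_monom)
    also have "\<dots> = 0"
      using w geometric_sum[of w l] by simp
    finally have "laurent_eval (laurent_of_poly ?C) w = 0"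
      using w by (simp add: laurent_eval_of_poly)
    moreover have "laurent_eval (laurent_of_poly p) w = 0"
      using zero[of w] w unfolding P by (simp add: laurent_eval_mult)
    ultimately have "laurent_eval (laurent_of_poly r) w = 0"
      using w unfolding eq by (simp add: laurent_of_poly_add laurent_of_poly_mult laurent_eval_add laurent_eval_mult)
    then show ?thesis
      using w by (simp add: laurent_eval_of_poly)
  qed
  moreover have "card ?S = l - 1"
    using l1 finite_roots_unity[of l] card_roots_unity_eq[of l] by (subst card_Diff_singleton) auto
  ultimately have "map_poly of_int r = (0 :: complex poly)" if "degree r < l - 1"
    using that map_poly_degree_leq[of "of_int :: int \<Rightarrow> complex" r]
    by (intro poly_eqI_degree[where A = ?S]) auto
  then have "r = 0"
    using r by (metis coeff_0 coeff_map_poly of_int_0 of_int_eq_0_iff poly_eqI)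
  then have "P = laurent_of_poly ?C * (Poly_Mapping.single (- int d) 1 * laurent_of_poly q)"
    unfolding P eq by (simp add: laurent_of_poly_mult mult_ac)
  then show ?thesis ..
qed


section \<open>Power series of infinite products\<close>

text \<open>The derivative is bounded on the closed disc, so the mean value inequality applies. The
  bound lets the product over \<open>h (q ^ n)\<close> be dominated by a geometric series.\<close>

lemma holomorphic_bound_minus_1:
  assumes "h holomorphic_on ball 0 R" "r < R" "h 0 = (1 :: complex)"
  obtains C where "\<And>w. norm w \<le> r \<Longrightarrow> norm (h w - 1) \<le> C * norm w"
proof -
  have sub: "cball 0 r \<subseteq> ball (0 :: complex) R"
    using assms by auto
  have "deriv h holomorphic_on ball 0 R"
    using assms by (intro holomorphic_deriv) auto
  then have "continuous_on (cball 0 r) (deriv h)"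
    using sub by (meson continuous_on_subset holomorphic_on_imp_continuous_on)
  then have "bounded (deriv h ` cball 0 r)"
    by (intro compact_imp_bounded compact_continuous_image) auto
  then obtain C where C: "\<And>w. w \<in> cball 0 r \<Longrightarrow> norm (deriv h w) \<le> C"
    unfolding bounded_iff by blast
  have der: "(h has_field_derivative deriv h w) (at w within cball 0 r)" if "w \<in> cball 0 r" for w
    using that sub assms(1) holomorphic_derivI[of h "ball 0 R" w "cball 0 r"] by auto
  have "norm (h w - 1) \<le> C * norm w" if "norm w \<le> r" for w
  proof -
    have "0 \<le> r"
      using that norm_ge_zero order_trans by blast
    then show ?thesis
      using field_differentiable_bound[OF convex_cball der C, of w 0] that assms(3) by simp
  qed
  then show ?thesis
    using that by blast
qed

text \<open>The partial products converge uniformly on a closed disc, so their limit is holomorphic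
  and their Taylor coefficients converge to those of the limit. By \<open>stable\<close>, each of
  these coefficients is eventually constant.\<close>

lemma power_series_prodinf:
  fixes h :: "complex \<Rightarrow> complex"
  assumes holo: "h holomorphic_on ball 0 R" and R: "R \<le> 1" and h0: "h 0 = 1"
    and q: "norm q < R"
    and exp: "\<And>M. (\<lambda>w. \<Prod>s<M. h (w ^ Suc s)) has_fps_expansion F M"
    and stable: "\<And>N M. N \<le> M \<Longrightarrow> fps_nth (F M) N = a N"
  shows "(\<lambda>N. a N * q ^ N) sums prodinf (\<lambda>n. h (q ^ Suc n))"
proof -
  \<comment> \<open>A radius strictly in between gives a compact disc with uniform estimates and
    \<open>q\<close> in its interior; \<open>r < 1\<close> keeps the powers of its points inside
    it.\<close>
  obtain r where r: "norm q < r" "r < R"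
    using q dense by blast
  then have r01: "0 < r" "r < 1"
    using R le_less_trans[OF norm_ge_zero] by auto
  have pow: "norm (w ^ Suc s) \<le> r ^ Suc s" "norm (w ^ Suc s) \<le> r" if "norm w \<le> r" for w :: complex and s
  proof -
    show "norm (w ^ Suc s) \<le> r ^ Suc s"
      using that unfolding norm_power by (intro power_mono) auto
    also have "r ^ Suc s \<le> r ^ 1"
      using r01 by (intro power_decreasing) auto
    finally show "norm (w ^ Suc s) \<le> r"
      by simp
  qed
  have ball: "w ^ Suc s \<in> ball 0 R" if "norm w \<le> r" for w :: complex and s
    using le_less_trans[OF pow(2)[OF that] r(2)] by (simp del: power_Suc)
  obtain C where C: "\<And>w. norm w \<le> r \<Longrightarrow> norm (h w - 1) \<le> C * norm w"
    using holomorphic_bound_minus_1[OF holo r(2) h0] by blast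
  have bound: "norm (h (w ^ Suc s) - 1) \<le> \<bar>C\<bar> * r ^ Suc s" if "norm w \<le> r" for w s
  proof -
    have "norm (h (w ^ Suc s) - 1) \<le> C * norm (w ^ Suc s)"
      using that by (intro C pow)
    also have "\<dots> \<le> \<bar>C\<bar> * r ^ Suc s"
      using pow(1)[OF that] by (intro mult_mono) auto
    finally show ?thesis .
  qed
  have summ: "summable (\<lambda>s. \<bar>C\<bar> * r ^ Suc s)"
    using r01 by (intro summable_mult) (simp add: summable_geometric summable_mult)
  define g where "g = (\<lambda>w. prodinf (\<lambda>n. h (w ^ Suc n)))"
  let ?P = "\<lambda>M w. \<Prod>s<M. h (w ^ Suc s)"
  have holo_s: "(\<lambda>w. h (w ^ Suc s)) holomorphic_on ball 0 r" for s
  proof -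
    have "(h \<circ> (\<lambda>w. w ^ Suc s)) holomorphic_on ball 0 r"
      using ball by (intro holomorphic_on_compose_gen[OF _ holo] holomorphic_intros) auto
    then show ?thesis
      by (simp add: o_def)
  qed
  have cont_s: "continuous_on (cball 0 r) (\<lambda>w. h (w ^ Suc s))" for s
  proof (rule continuous_on_compose2[OF holomorphic_on_imp_continuous_on[OF holo]])
    show "(\<lambda>w. w ^ Suc s) ` cball 0 r \<subseteq> ball (0 :: complex) R"
      using ball by auto
  qed (intro continuous_intros)
  have "uniformly_convergent_on (cball 0 r) (\<lambda>M w. \<Sum>s<M. norm (h (w ^ Suc s) - 1))"
    using bound summ by (intro Weierstrass_m_test'[where M = "\<lambda>s. \<bar>C\<bar> * r ^ Suc s"])
      (auto simp del: power_Suc)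
  then have "uniformly_convergent_on (cball 0 r) ?P"
    using cont_s by (intro uniformly_convergent_on_prod') auto
  then obtain g' where g': "uniform_limit (cball 0 r) ?P g' sequentially"
    unfolding uniformly_convergent_on_def by blast
  have g'_eq: "g' w = g w" if "w \<in> cball 0 r" for w
  proof -
    have "summable (\<lambda>s. norm (h (w ^ Suc s) - 1))"
      using bound[of w] that by (intro summable_comparison_test'[OF summ]) (auto simp del: power_Suc)
    then have "convergent_prod (\<lambda>s. h (w ^ Suc s))"
      by (intro abs_convergent_prod_imp_convergent_prod)
        (simp add: abs_convergent_prod_conv_summable del: power_Suc)
    then have "(\<lambda>M. ?P M w) \<longlonglongrightarrow> g w"
      unfolding g_def by (intro has_prod_imp_tendsto' convergent_prod_has_prod)
    then show ?thesis
      using tendsto_uniform_limitI[OF g' that] LIMSEQ_unique by blast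
  qed
  have holo_P: "?P M holomorphic_on ball 0 r" and cont_P: "continuous_on (cball 0 r) (?P M)" for M
    using holo_s cont_s by (intro holomorphic_on_prod continuous_on_prod; blast)+
  have "g' holomorphic_on ball 0 r"
    by (rule holomorphic_uniform_limit[OF _ g']) (use holo_P cont_P in auto)
  moreover have "q \<in> ball 0 r"
    using r by simp
  ultimately have "(\<lambda>n. (deriv ^^ n) g' 0 / fact n * (q - 0) ^ n) sums g' q"
    by (rule holomorphic_power_series)
  moreover have "(deriv ^^ n) g' 0 / fact n = a n" for n
  proof -
    have lim: "(\<lambda>M. (deriv ^^ n) (?P M) 0) \<longlonglongrightarrow> (deriv ^^ n) g' 0"
      using r01 holo_P
      by (intro higher_deriv_complex_uniform_limit[where A = "ball 0 r"]
          uniform_limit_on_subset[OF g']) auto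
    have ev: "\<forall>\<^sub>F M in sequentially. (deriv ^^ n) (?P M) 0 = fact n * a n"
      using eventually_ge_at_top[of n]
    proof eventually_elim
      case (elim M)
      then show ?case
        using fps_nth_fps_expansion[OF exp[of M], of n] stable[of n M] by (simp add: field_simps del: power_Suc)
    qed
    have "(deriv ^^ n) g' 0 = fact n * a n"
      by (rule LIMSEQ_unique[OF lim tendsto_eventually[OF ev]])
    then show ?thesis by simp
  qed
  ultimately show ?thesis
    using g'_eq[of q] r by (simp add: g_def)
qed

text \<open>The point \<open>q = 0\<close> is left out because \<open>e2pi\<close> never takes the
  value 0.\<close>

lemma power_series_punctured_unique:
  fixes a b :: "nat \<Rightarrow> complex"
  assumes "R > 0"
    and a: "\<And>q. 0 < norm q \<Longrightarrow> norm q < R \<Longrightarrow> (\<lambda>n. a n * q ^ n) sums f q"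
    and b: "\<And>q. 0 < norm q \<Longrightarrow> norm q < R \<Longrightarrow> (\<lambda>n. b n * q ^ n) sums f q"
  shows "a = b"
proof -
  define d where "d = Abs_fps (\<lambda>n. a n - b n)"
  \<comment> \<open>The extra factor \<open>fps_X\<close> makes the sum vanish at \<open>q = 0\<close> as well.\<close>
  have sums: "(\<lambda>n. fps_nth (fps_X * d) n * q ^ n) sums 0" if "norm q < R" for q
  proof (cases "q = 0")
    case False
    then have "(\<lambda>n. a n * q ^ n - b n * q ^ n) sums (f q - f q)"
      using that a[of q] b[of q] by (intro sums_diff) auto
    then have "(\<lambda>n. (a n * q ^ n - b n * q ^ n) * q) sums (0 * q)"
      by (intro sums_mult2) simp
    then have "(\<lambda>n. fps_nth (fps_X * d) (Suc n) * q ^ Suc n) sums 0"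
      by (simp add: d_def algebra_simps)
    then show ?thesis
      by (rule sums_Suc_imp[rotated]) simp
  next
    case True
    then show ?thesis
      using sums_0 by (auto simp: power_0_left if_distrib cong: if_cong intro!: sums_0)
  qed
  have "ereal (R / 2) \<le> fps_conv_radius (fps_X * d)"
    unfolding fps_conv_radius_def
    by (rule conv_radius_geI_ex') (use sums assms(1) in \<open>auto simp: sums_iff\<close>)
  then have "fps_conv_radius (fps_X * d) > 0"
    using assms(1) by (auto intro: less_le_trans[rotated])
  moreover have "eventually (\<lambda>q. q \<in> ball 0 R) (nhds (0 :: complex))"
    using assms(1) by (intro eventually_nhds_in_open) auto
  then have "eventually (\<lambda>q. eval_fps (fps_X * d) q = 0) (nhds 0)"
    by eventually_elim (use sums in \<open>auto simp: eval_fps_def sums_iff\<close>)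
  ultimately have "(\<lambda>_. 0) has_fps_expansion (fps_X * d)"
    by (simp add: has_fps_expansion_def)
  then have "fps_X * d = 0"
    using fps_expansion_unique_complex has_fps_expansion_0 by blast
  then have "fps_nth d n = 0" for n
    by simp
  then show ?thesis
    by (auto simp: d_def)
qed


section \<open>The crank\<close>

text \<open>
  The exponent of \<open>\<zeta>\<close> attached to a colour \<open>c < k\<close> depends on \<open>r = c mod l\<close> only. As \<open>r\<close> runs through
  \<open>0, \<dots>, l - 1\<close>, it takes the values \<open>1, -1, 3, -3, \<dots>, l - 2, -(l - 2), 0\<close>, which represent every
  residue class modulo \<open>l\<close> once; the colour \<open>k\<close>, missing from the last block, would have exponent \<open>0\<close>.
\<close>

definition crank_exp :: "nat \<Rightarrow> nat \<Rightarrow> int" where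
  "crank_exp l r = (if r = l - 1 then 0 else if even r then int r + 1 else - int r)"

text \<open>The colours \<open>k\<close> and \<open>k + 1\<close>, whose parts are distinct, carry
  the exponents of the numerator of \<open>crank_C\<close>.\<close>

definition colour_exp :: "nat \<Rightarrow> nat \<Rightarrow> nat \<Rightarrow> int" where
  "colour_exp l k c = (if c < k then crank_exp l (c mod l) else if c = k then 2 else -2)"

definition crank_coeff :: "nat \<Rightarrow> nat \<Rightarrow> int \<Rightarrow> laurent" where
  "crank_coeff l k N =
     (\<Sum>M\<in>coloured_partitions k 2 N. Poly_Mapping.single (\<Sum>y\<in>#M. colour_exp l k (snd y)) 1)"

lemma crank_coeff_negative: "N < 0 \<Longrightarrow> crank_coeff l k N = 0"
  by (simp add: crank_coeff_def coloured_partitions_negative)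

lemma power_int_sum_mset:
  fixes x :: "'a::field"
  assumes "x \<noteq> 0"
  shows "x powi (\<Sum>y\<in>#M. f y) = (\<Prod>y\<in>#M. x powi f y)"
  by (induction M) (use assms in \<open>simp_all add: power_int_add\<close>)

lemma laurent_eval_crank_coeff:
  assumes "x \<noteq> 0"
  shows "laurent_eval (crank_coeff l k N) x =
           (\<Sum>M\<in>coloured_partitions k 2 N. \<Prod>y\<in>#M. x powi colour_exp l k (snd y))"
  using assms by (simp add: crank_coeff_def laurent_eval_sum power_int_sum_mset)

lemma laurent_eval_crank_coeff_1: "laurent_eval (crank_coeff l k N) 1 = of_nat (pkj k 2 N)"
  by (simp add: laurent_eval_crank_coeff pkj_def)

lemma crank_exp_bounds:
  assumes "odd l" "l \<ge> 3" "r < l"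
  shows "\<bar>crank_exp l r\<bar> \<le> int (l - 2)"
proof (cases "r = l - 1")
  case False
  show ?thesis
  proof (cases "even r")
    case True
    \<comment> \<open>For even \<open>r\<close> the exponent is \<open>r + 1\<close>, which would
      exceed the bound at \<open>r = l - 2\<close>; the parity of \<open>l\<close> rules this
      out.\<close>
    have "r \<noteq> l - 2"
    proof
      assume "r = l - 2"
      then have "l = r + 2"
        using assms(2) by simp
      then show False
        using True assms(1) by simp
    qed
    then show ?thesis
      using True False assms by (auto simp: crank_exp_def)
  next
    case odd: False
    then show ?thesis
      using False assms by (auto simp: crank_exp_def)
  qed
qed (simp add: crank_exp_def)

text \<open>All nonzero exponents are odd, so a difference of two of them is even; as a multiple of
  the odd \<open>l\<close> below \<open>2 * l\<close> in absolute value it is 0. If one exponent is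
  0, the difference is already below \<open>l\<close> in absolute value.\<close>

lemma crank_exp_inj_mod:
  assumes "odd l" "r < l" "r' < l" "int l dvd crank_exp l r - crank_exp l r'"
  shows "r = r'"
proof -
  have small: "x = 0" if "int l dvd x" "\<bar>x\<bar> < int l" for x
    using that dvd_imp_le_int[of x "int l"] by force
  have even_small: "x = 0" if "int l dvd x" "even x" "\<bar>x\<bar> < 2 * int l" for x
  proof -
    have "coprime (int l) 2"
      using assms(1) by simp
    then have "int l * 2 dvd x"
      using that by (intro divides_mult) auto
    then show ?thesis
      using that(3) dvd_imp_le_int[of x "int l * 2"] by force
  qed
  have "r = l - 1 \<or> int r + 1 < int l" "r' = l - 1 \<or> int r' + 1 < int l"
    using assms(2,3) by linarith+
  then show ?thesis
    using assms(2-) small[of "crank_exp l r - crank_exp l r'"]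
      even_small[of "crank_exp l r - crank_exp l r'"] assms(1)
    by (auto simp: crank_exp_def split: if_splits)
qed

lemma prod_lessThan_add:
  fixes f :: "nat \<Rightarrow> 'a::comm_monoid_mult"
  shows "(\<Prod>c<a + b. f c) = (\<Prod>c<a. f c) * (\<Prod>c<b. f (a + c))"
  by (induction b) (simp_all add: mult.assoc)

lemma prod_mod:
  fixes g :: "nat \<Rightarrow> 'a::comm_monoid_mult"
  shows "(\<Prod>c<l * n. g (c mod l)) = (\<Prod>r<l. g r) ^ n"
proof (induction n)
  case (Suc n)
  have "(\<Prod>c<l * Suc n. g (c mod l)) = (\<Prod>c<l * n + l. g (c mod l))"
    by (simp add: add.commute)
  also have "\<dots> = (\<Prod>c<l * n. g (c mod l)) * (\<Prod>c<l. g ((l * n + c) mod l))"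
    by (rule prod_lessThan_add)
  also have "(\<Prod>c<l. g ((l * n + c) mod l)) = (\<Prod>c<l. g c)"
    by (intro prod.cong) auto
  finally show ?case
    by (simp add: Suc.IH mult.commute)
qed simp

text \<open>The consecutive residues \<open>2 * i\<close> and \<open>2 * i + 1\<close> carry the
  opposite exponents \<open>2 * i + 1\<close> and \<open>-(2 * i + 1)\<close>.\<close>

lemma prod_crank_exp:
  fixes g :: "int \<Rightarrow> 'a::comm_monoid_mult"
  assumes "odd l"
  shows "(\<Prod>r<l - 1. g (crank_exp l r)) =
           (\<Prod>a\<in>{a\<in>{1..l - 2}. odd a}. g (int a) * g (- int a))"
proof -
  obtain t where t: "l = 2 * t + 1"
    using assms by (rule oddE)
  have pairs: "(\<Prod>r<2 * n. f r) = (\<Prod>i<n. f (2 * i) * f (2 * i + 1))" for f :: "nat \<Rightarrow> 'a" and n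
    by (induction n) (simp_all add: mult.assoc)
  have "(\<Prod>r<l - 1. g (crank_exp l r)) = (\<Prod>i<t. g (int (2 * i + 1)) * g (- int (2 * i + 1)))"
    unfolding t by (simp only: add_diff_cancel_right' pairs) (intro prod.cong refl, auto simp: crank_exp_def add.commute)
  also have "\<dots> = (\<Prod>a\<in>(\<lambda>i. 2 * i + 1) ` {..<t}. g (int a) * g (- int a))"
    by (subst prod.reindex) (auto simp: inj_on_def)
  also have "(\<lambda>i. 2 * i + 1) ` {..<t} = {a\<in>{1..l - 2}. odd a}"
    unfolding t by (auto elim!: oddE)
  finally show ?thesis .
qed

text \<open>The \<open>k\<close> colours form \<open>m\<close> complete blocks of length
  \<open>l\<close> and one block without the residue \<open>l - 1\<close>. Hence exponent 0 occurs
  \<open>m\<close> times and every other one \<open>m + 1\<close> times, as in the denominator of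
  \<open>crank_C\<close>.\<close>

lemma prod_colours:
  fixes g :: "int \<Rightarrow> 'a::comm_monoid_mult"
  assumes "odd l" "k = l * m + (l - 1)"
  shows "(\<Prod>c<k. g (crank_exp l (c mod l))) =
           g 0 ^ m * (\<Prod>a\<in>{a\<in>{1..l - 2}. odd a}. g (int a) * g (- int a)) ^ (m + 1)"
proof -
  let ?A = "\<Prod>r<l - 1. g (crank_exp l r)"
  have "(\<Prod>r<l. g (crank_exp l r)) = (\<Prod>r<Suc (l - 1). g (crank_exp l r))"
    using assms(1) by (cases l) auto
  also have "\<dots> = ?A * g 0"
    by (simp add: crank_exp_def)
  finally have full: "(\<Prod>r<l. g (crank_exp l r)) = ?A * g 0" .
  have "(\<Prod>c<k. g (crank_exp l (c mod l))) =
      (\<Prod>c<l * m. g (crank_exp l (c mod l))) * (\<Prod>c<l - 1. g (crank_exp l ((l * m + c) mod l)))"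
    unfolding assms(2) by (rule prod_lessThan_add)
  also have "(\<Prod>c<l - 1. g (crank_exp l ((l * m + c) mod l))) = ?A"
    by (intro prod.cong) auto
  also have "(\<Prod>c<l * m. g (crank_exp l (c mod l))) = (?A * g 0) ^ m"
    using prod_mod[of "\<lambda>r. g (crank_exp l r)" l m] by (simp only: full)
  finally show ?thesis
    unfolding prod_crank_exp[OF assms(1), symmetric] by (simp add: power_mult_distrib mult_ac)
qed

section \<open>Truncated crank products and the analytic expansion\<close>

definition crank_trunc :: "nat \<Rightarrow> nat \<Rightarrow> complex \<Rightarrow> nat \<Rightarrow> complex fps" where
  "crank_trunc l k x M =
     (\<Prod>s=1..M. (1 + fps_const (x powi 2) * fps_X ^ s) * (1 + fps_const (x powi -2) * fps_X ^ s) *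
        (\<Prod>c<k. inverse (1 - fps_const (x powi crank_exp l (c mod l)) * fps_X ^ s)))"

lemma crank_trunc_nth:
  assumes "x \<noteq> 0" "N \<le> M"
  shows "fps_nth (crank_trunc l k x M) N = laurent_eval (crank_coeff l k (int N)) x"
proof -
  let ?u = "\<lambda>y. x powi colour_exp l k (snd y)" and ?D = "{y :: nat \<times> nat. k \<le> snd y}"
  have "restricted_gf ({1..M} \<times> {..<k + 2}) ?D fst ?u =
      (\<Prod>s\<in>{1..M}. \<Prod>c\<in>{..<k + 2}.
         if k \<le> c then 1 + fps_const (x powi colour_exp l k c) * fps_X ^ s
         else inverse (1 - fps_const (x powi colour_exp l k c) * fps_X ^ s))"
    unfolding prod.cartesian_product
    by (subst restricted_gf_eq_prod) (auto simp: case_prod_unfold)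
  also have "\<dots> = crank_trunc l k x M"
    unfolding crank_trunc_def
    by (intro prod.cong refl) (simp add: numeral_2_eq_2 colour_exp_def mult_ac)
  finally have gf: "restricted_gf ({1..M} \<times> {..<k + 2}) ?D fst ?u = crank_trunc l k x M" .
  have "laurent_eval (crank_coeff l k (int N)) x =
      fps_nth (restricted_gf ({1..M} \<times> {..<k + 2}) ?D fst ?u) N"
    unfolding laurent_eval_crank_coeff[OF assms(1)]
      coloured_partitions_eq_restricted_msets[OF assms(2)] restricted_gf_def fps_nth_Abs_fps ..
  then show ?thesis
    by (simp only: gf)
qed

text \<open>One factor of the crank product as a function of \<open>y = q^n\<close>, the form
  required by \<open>power_series_prodinf\<close>.\<close>

definition crank_factor :: "nat \<Rightarrow> nat \<Rightarrow> complex \<Rightarrow> complex \<Rightarrow> complex" where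
  "crank_factor l k x y = (1 + x powi 2 * y) * (1 + x powi (-2) * y) *
     (\<Prod>c<k. inverse (1 - x powi crank_exp l (c mod l) * y))"

lemma crank_C_eq:
  assumes "odd l" "k = l * m + (l - 1)"
  shows "crank_C l m z \<tau> = prodinf (\<lambda>n. crank_factor l k (e2pi z) (e2pi \<tau> ^ Suc n))"
proof -
  have den: "(1 - y) ^ m * (\<Prod>a\<in>{a\<in>{1..l - 2}. odd a}.
        (1 - x powi int a * y) * (1 - x powi (- int a) * y)) ^ (m + 1) =
      (\<Prod>c<k. 1 - x powi crank_exp l (c mod l) * y)" for x y :: complex
    by (subst prod_colours[OF assms, of "\<lambda>i. 1 - x powi i * y"])
      (simp only: power_int_0_right mult_1_left)
  show ?thesis
    unfolding crank_C_def crank_factor_def Let_def den divide_inverse prod_inversef[symmetric] o_def ..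
qed

lemma crank_factor_has_fps_expansion:
  "(\<lambda>w. \<Prod>s<M. crank_factor l k x (w ^ Suc s)) has_fps_expansion crank_trunc l k x M"
  unfolding crank_factor_def crank_trunc_def One_nat_def prod.atLeast1_atMost_eq
  by (intro fps_expansion_intros) auto

lemma norm_e2pi: "norm (e2pi z) = exp (- 2 * pi * Im z)"
  by (simp add: e2pi_def)

lemma e2pi_nonzero [simp]: "e2pi z \<noteq> 0"
  by (simp add: e2pi_def)

lemma e2pi_Ln:
  assumes "q \<noteq> 0"
  shows "e2pi (Ln q / (2 * of_real pi * \<i>)) = q"
  using assms by (simp add: e2pi_def)

text \<open>The radius is the reciprocal of an upper bound for the norm of
  \<open>e2pi z powi e\<close> with \<open>\<bar>e\<bar> \<le> l - 2\<close>, so no denominator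
  vanishes in the disc.\<close>

lemma crank_factor_holomorphic:
  assumes "odd l" "l \<ge> 3"
  shows "crank_factor l k (e2pi z) holomorphic_on ball 0 (exp (- (2 * pi * (real (l - 2) * \<bar>Im z\<bar>))))"
proof -
  have "1 - e2pi z powi crank_exp l (c mod l) * y \<noteq> 0"
    if y: "norm y < exp (- (2 * pi * (real (l - 2) * \<bar>Im z\<bar>)))" for y c
  proof -
    define e where "e = crank_exp l (c mod l)"
    have "c mod l < l"
      using assms by simp
    then have "\<bar>e\<bar> \<le> int (l - 2)"
      using crank_exp_bounds[OF assms] by (simp add: e_def)
    then have "\<bar>real_of_int e\<bar> \<le> real (l - 2)"
      by linarith
    then have "\<bar>real_of_int e * Im z\<bar> \<le> real (l - 2) * \<bar>Im z\<bar>"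
      unfolding abs_mult by (rule mult_right_mono) simp
    then have le: "pi * (- (real_of_int e * Im z)) \<le> pi * (real (l - 2) * \<bar>Im z\<bar>)"
      by (intro mult_left_mono) auto
    have norm: "norm (e2pi z powi e) = exp (2 * (pi * (- (real_of_int e * Im z))))"
      by (simp add: norm_power_int norm_e2pi mult_ac exp_power_int)
    have "norm (e2pi z powi e) \<le> exp (2 * pi * (real (l - 2) * \<bar>Im z\<bar>))"
      unfolding norm mult.assoc[of 2 pi] using le
      by (simp only: exp_le_cancel_iff mult_le_cancel_left_pos zero_less_numeral)
    then have "norm (e2pi z powi e * y) < exp (2 * pi * (real (l - 2) * \<bar>Im z\<bar>)) * exp (- (2 * pi * (real (l - 2) * \<bar>Im z\<bar>)))"
      unfolding norm_mult using y by (intro mult_le_less_imp_less) auto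
    then have "norm (e2pi z powi e * y) < 1"
      by (simp add: exp_minus)
    then show ?thesis
      unfolding e_def by force
  qed
  then show ?thesis
    unfolding crank_factor_def by (auto intro!: holomorphic_intros)
qed

lemma crank_region_iff:
  "real (l - 2) * \<bar>Im z\<bar> < Im \<tau> \<longleftrightarrow> norm (e2pi \<tau>) < exp (- (2 * pi * (real (l - 2) * \<bar>Im z\<bar>)))"
  by (simp add: norm_e2pi)

lemma is_q_expansion_crank_coeff:
  assumes "odd l" "l \<ge> 3" "k = l * m + (l - 1)"
  shows "is_q_expansion l m (crank_coeff l k)"
  unfolding is_q_expansion_def
proof (intro conjI allI impI)
  fix z \<tau> assume reg: "real (l - 2) * \<bar>Im z\<bar> < Im \<tau>"
  show "(\<lambda>n. laurent_eval (crank_coeff l k (int n)) (e2pi z) * e2pi \<tau> ^ n) sums crank_C l m z \<tau>"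
    unfolding crank_C_eq[OF assms(1,3)]
  proof (rule power_series_prodinf[OF crank_factor_holomorphic[OF assms(1,2)]])
    show "exp (- (2 * pi * (real (l - 2) * \<bar>Im z\<bar>))) \<le> 1"
      by simp
    show "norm (e2pi \<tau>) < exp (- (2 * pi * (real (l - 2) * \<bar>Im z\<bar>)))"
      using reg crank_region_iff by blast
  qed (rule crank_factor_has_fps_expansion crank_trunc_nth | simp add: crank_factor_def)+
qed (simp add: crank_coeff_negative)

text \<open>For a fixed nonzero value of \<zeta> both expansions are power series in q with the same
  sums on a punctured disc. Their coefficients therefore agree at every nonzero \<zeta>, which
  determines a Laurent polynomial.\<close>

lemma is_q_expansion_unique:
  assumes "is_q_expansion l m c" "is_q_expansion l m c'"
  shows "c = c'"
proof
  fix N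
  show "c N = c' N"
  proof (cases "N < 0")
    case False
    show ?thesis
    proof (rule laurent_eqI)
      fix x :: complex assume "x \<noteq> 0"
      then obtain z where z: "x = e2pi z"
        using e2pi_Ln by metis
      define R where "R = exp (- (2 * pi * (real (l - 2) * \<bar>Im z\<bar>)))"
      \<comment> \<open>A logarithm provides some \<tau> with \<open>e2pi \<tau> = q\<close>, so
        every small nonzero \<open>q\<close> is reached.\<close>
      let ?T = "\<lambda>q. Ln q / (2 * of_real pi * \<i>)"
      have "(\<lambda>n. laurent_eval (b (int n)) x * q ^ n) sums crank_C l m z (?T q)"
        if "is_q_expansion l m b" "0 < norm q" "norm q < R" for b q
      proof -
        have q: "e2pi (?T q) = q"
          using that by (intro e2pi_Ln) auto
        then have "real (l - 2) * \<bar>Im z\<bar> < Im (?T q)"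
          unfolding crank_region_iff using that by (simp add: R_def)
        then have "(\<lambda>n. laurent_eval (b (int n)) (e2pi z) * e2pi (?T q) ^ n) sums crank_C l m z (?T q)"
          using that(1) unfolding is_q_expansion_def by blast
        then show ?thesis
          unfolding q z .
      qed
      note sums = this
      have "(\<lambda>n. laurent_eval (c (int n)) x) = (\<lambda>n. laurent_eval (c' (int n)) x)"
        by (rule power_series_punctured_unique[where R = R, OF _ sums[OF assms(1)] sums[OF assms(2)]])
          (simp add: R_def)
      moreover obtain n where "N = int n"
        using False by (metis nonneg_int_cases not_less)
      ultimately show "laurent_eval (c N) x = laurent_eval (c' N) x"
        by meson
    qed
  qed (use assms in \<open>simp add: is_q_expansion_def\<close>)
qed

section \<open>Specialisation at a nontrivial root of unity\<close>

lemma bij_betw_crank_exp_root_of_unity: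
  fixes x :: complex
  assumes "prime l" "odd l" "x ^ l = 1" "x \<noteq> 1"
  shows "bij_betw (\<lambda>r. x powi crank_exp l r) {..<l} {z. z ^ l = 1}"
proof (rule bij_betw_imageI)
  have l: "l > 0"
    using assms(1) prime_gt_0_nat by blast
  show inj: "inj_on (\<lambda>r. x powi crank_exp l r) {..<l}"
    using assms by (auto simp: inj_on_def root_of_unity_powi_eq_iff intro: crank_exp_inj_mod)
  have "(x powi i) ^ l = 1" for i
    using assms(3) by (metis power_int_commutes power_int_mult power_int_of_nat power_int_1_left mult.commute)
  \<comment> \<open>By injectivity there are \<open>l\<close> values, and there are only
    \<open>l\<close> roots of unity, so all of them are attained.\<close>
  then show "(\<lambda>r. x powi crank_exp l r) ` {..<l} = {z. z ^ l = 1}"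
    using card_roots_unity_eq[OF l] finite_roots_unity[of l] l card_image[OF inj]
    by (intro card_subset_eq) auto
qed

lemma prod_one_minus_root_of_unity:
  fixes Y :: "complex fps"
  assumes "l > 0" "fps_nth Y 0 = 0"
  shows "(\<Prod>z\<in>{z. z ^ l = 1}. 1 - fps_const z * Y) = 1 - Y ^ l"
proof -
  \<comment> \<open>The polynomial identity is carried over to power series by substituting
    \<open>Y\<close>, which is legitimate because its constant term is 0.\<close>
  have "fps_compose (fps_of_poly (\<Prod>z\<in>{z. z ^ l = 1}. [:1, - z:])) Y =
      fps_compose (fps_of_poly (1 - Polynomial.monom 1 l)) Y"
    by (simp only: prod_roots_of_unity(2)[OF assms(1)])
  then show ?thesis
    using assms(2)
    by (simp add: fps_of_poly_prod fps_compose_prod_distrib fps_of_poly_linear' fps_compose_add_distrib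
        fps_compose_mult_distrib fps_of_poly_diff fps_compose_sub_distrib fps_of_poly_monom'
        fps_X_power_compose flip: fps_const_neg)
qed

definition fps_supported_on_multiples :: "nat \<Rightarrow> 'a::zero fps \<Rightarrow> bool" where
  "fps_supported_on_multiples l f \<longleftrightarrow> (\<forall>n. fps_nth f n \<noteq> 0 \<longrightarrow> l dvd n)"

lemma fps_supported_on_multiples_mult:
  fixes f g :: "'a::semiring_0 fps"
  assumes "fps_supported_on_multiples l f" "fps_supported_on_multiples l g"
  shows "fps_supported_on_multiples l (f * g)"
  unfolding fps_supported_on_multiples_def
proof (intro allI impI)
  fix n assume "fps_nth (f * g) n \<noteq> 0"
  then obtain i where "i \<le> n" "fps_nth f i * fps_nth g (n - i) \<noteq> 0"
    unfolding fps_mult_nth by (metis (mono_tags, lifting) atLeastAtMost_iff sum.neutral)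
  then have "fps_nth f i \<noteq> 0" "fps_nth g (n - i) \<noteq> 0"
    using mult_zero_left mult_zero_right by metis+
  then have "l dvd i" "l dvd n - i"
    using assms unfolding fps_supported_on_multiples_def by blast+
  then show "l dvd n"
    using \<open>i \<le> n\<close> by (metis dvd_add le_add_diff_inverse)
qed

lemma fps_supported_on_multiples_1: "fps_supported_on_multiples l (1 :: 'a::zero_neq_one fps)"
  by (simp add: fps_supported_on_multiples_def)

lemma fps_supported_on_multiples_prod:
  fixes f :: "'b \<Rightarrow> 'a::comm_semiring_1 fps"
  assumes "\<And>i. i \<in> A \<Longrightarrow> fps_supported_on_multiples l (f i)"
  shows "fps_supported_on_multiples l (\<Prod>i\<in>A. f i)"
  using assms by (induction A rule: infinite_finite_induct)
    (auto intro: fps_supported_on_multiples_mult fps_supported_on_multiples_1)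

lemma fps_supported_on_multiples_power:
  fixes f :: "'a::comm_semiring_1 fps"
  assumes "fps_supported_on_multiples l f"
  shows "fps_supported_on_multiples l (f ^ n)"
  using assms by (induction n)
    (auto intro: fps_supported_on_multiples_mult fps_supported_on_multiples_1)

text \<open>Since \<open>E\<close> has constant term 1, \<open>fps_nth F N\<close> is the
  coefficient of \<open>E * F\<close> minus multiples of \<open>fps_nth F (N - i)\<close> for
  positive multiples \<open>i\<close> of \<open>l\<close>. These vanish by induction, so
  \<open>E\<close> is removed without being inverted.\<close>

lemma fps_nth_eq_0_on_residue_class:
  fixes E F :: "'a::comm_ring_1 fps"
  assumes "fps_supported_on_multiples l E" "fps_nth E 0 = 1"
    and zero: "\<And>N. N \<le> M \<Longrightarrow> P N \<Longrightarrow> fps_nth (E * F) N = 0"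
    and step: "\<And>N i. i \<le> N \<Longrightarrow> l dvd i \<Longrightarrow> P N \<Longrightarrow> P (N - i)"
    and "N \<le> M" "P N"
  shows "fps_nth F N = 0"
  using assms(5,6)
proof (induction N rule: less_induct)
  case (less N)
  have "0 = fps_nth (E * F) N"
    using zero less.prems by simp
  also have "\<dots> = (\<Sum>i=0..N. fps_nth E i * fps_nth F (N - i))"
    by (rule fps_mult_nth)
  also have "\<dots> = (\<Sum>i\<in>{0}. fps_nth E i * fps_nth F (N - i))"
  proof (intro sum.mono_neutral_right ballI)
    fix i assume i: "i \<in> {0..N} - {0}"
    show "fps_nth E i * fps_nth F (N - i) = 0"
    proof (cases "fps_nth E i = 0")
      case False
      then have "P (N - i)"
        using assms(1) step i less.prems by (auto simp: fps_supported_on_multiples_def)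
      then show ?thesis
        using less i by simp
    qed simp
  qed auto
  finally show ?case
    using assms(2) by simp
qed

lemma QuadRes_cong:
  assumes "[a = b] (mod p)" "QuadRes p a"
  shows "QuadRes p b"
  using assms unfolding QuadRes_def by (meson cong_trans)

text \<open>With one more factor of exponent 0, the \<open>k\<close> denominator factors form
  \<open>m + 1\<close> complete residue systems, each with product
  \<open>1 - fps_X ^ (l * s)\<close>. Clearing them leaves that one factor,
  \<open>1 - fps_X ^ s\<close>, which completes the triple product.\<close>

lemma crank_trunc_root_of_unity:
  fixes x :: complex
  assumes "prime l" "odd l" "k = l * m + (l - 1)" "x ^ l = 1" "x \<noteq> 1"
  shows "(\<Prod>s=1..M. (1 - fps_X ^ (l * s)) ^ (m + 1)) * crank_trunc l k x M =
     (\<Prod>s=1..M. (1 - fps_X ^ s) * (1 + fps_const (x\<^sup>2) * fps_X ^ s) *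
        (1 + fps_const (inverse (x\<^sup>2)) * fps_X ^ s))"
proof -
  have l: "l > 0"
    using assms(1) prime_gt_0_nat by blast
  have factor: "(1 - fps_X ^ (l * s)) ^ (m + 1) *
      ((1 + fps_const (x powi 2) * fps_X ^ s) * (1 + fps_const (x powi -2) * fps_X ^ s) *
        (\<Prod>c<k. inverse (1 - fps_const (x powi crank_exp l (c mod l)) * fps_X ^ s))) =
      (1 - fps_X ^ s) * (1 + fps_const (x\<^sup>2) * fps_X ^ s) *
        (1 + fps_const (inverse (x\<^sup>2)) * fps_X ^ s)" if "s \<ge> 1" for s
  proof -
    let ?g = "\<lambda>r. 1 - fps_const (x powi crank_exp l r) * fps_X ^ s :: complex fps"
    have "(\<Prod>r<l. ?g r) = (\<Prod>z\<in>{z. z ^ l = 1}. 1 - fps_const z * fps_X ^ s)"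
      using assms by (intro prod.reindex_bij_betw bij_betw_crank_exp_root_of_unity) auto
    also have "\<dots> = 1 - (fps_X ^ s) ^ l"
      using l that by (intro prod_one_minus_root_of_unity) auto
    also have "(fps_X ^ s) ^ l = (fps_X ^ (l * s) :: complex fps)"
      by (simp only: power_mult[symmetric] mult.commute[of s l])
    finally have "(1 - fps_X ^ (l * s)) ^ (m + 1) = (\<Prod>c<l * (m + 1). ?g (c mod l))"
      using prod_mod[of ?g l "m + 1"] by simp
    also have "l * (m + 1) = Suc k"
      using l assms(3) by simp
    also have "(\<Prod>c<Suc k. ?g (c mod l)) = (\<Prod>c<k. ?g (c mod l)) * (1 - fps_X ^ s)"
    proof -
      have "k mod l = l - 1"
        unfolding assms(3) mod_mult_self4 using l by simp
      then show ?thesis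
        by (simp add: crank_exp_def)
    qed
    finally have E: "(1 - fps_X ^ (l * s)) ^ (m + 1) = (\<Prod>c<k. ?g (c mod l)) * (1 - fps_X ^ s)" .
    have "(\<Prod>c<k. ?g (c mod l)) * (\<Prod>c<k. inverse (?g (c mod l))) = 1"
      unfolding prod.distrib[symmetric]
      using that by (intro prod.neutral ballI) (simp add: inverse_mult_eq_1')
    then show ?thesis
      unfolding E by (simp add: power_int_minus mult_ac)
  qed
  show ?thesis
    unfolding crank_trunc_def prod.distrib[symmetric] by (intro prod.cong refl factor) simp
qed

lemma crank_coeff_vanishes:
  fixes x :: complex
  assumes "prime l" "odd l" "k = l * m + (l - 1)" "x ^ l = 1" "x \<noteq> 1"
    and nonres: "\<not> QuadRes (int l) (8 * N + 1)"
  shows "laurent_eval (crank_coeff l k N) x = 0"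
proof (cases "N < 0")
  case False
  define n where "n = nat N"
  have l: "l > 0"
    using assms(1) prime_gt_0_nat by blast
  have x0: "x \<noteq> 0"
    using assms(4) l by (auto simp: power_0_left)
  \<comment> \<open>The triple product is applied with \<open>x\<^sup>2\<close> as its variable, and
    \<open>jacobi_coeff_eq_0\<close> excludes -1. If \<open>x\<^sup>2 = -1\<close>, then
    \<open>(x ^ l)\<^sup>2 = (-1) ^ l = -1\<close> for odd \<open>l\<close>.\<close>
  have x2: "x\<^sup>2 \<noteq> -1"
  proof
    assume "x\<^sup>2 = -1"
    then have "(x ^ l)\<^sup>2 = (-1) ^ l"
      by (metis mult.commute power_mult)
    then show False
      using assms(2,4) by simp
  qed
  let ?E = "\<Prod>s=1..n. (1 - fps_X ^ (l * s)) ^ (m + 1) :: complex fps"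
  let ?P = "\<lambda>n. \<not> QuadRes (int l) (8 * int n + 1)"
  have "fps_nth (crank_trunc l k x n) n = 0"
  \<comment> \<open>Factors up to \<open>n\<close> determine the coefficient of index
    \<open>n\<close>, so all products stop there. The predicate \<open>?P\<close> depends only on
    the residue modulo \<open>l\<close>, hence survives the subtraction of multiples of
    \<open>l\<close>.\<close>
  proof (rule fps_nth_eq_0_on_residue_class[where E = ?E and M = n and P = ?P and l = l])
    show "fps_supported_on_multiples l ?E"
      by (intro fps_supported_on_multiples_prod fps_supported_on_multiples_power)
        (auto simp: fps_supported_on_multiples_def split: if_splits)
    have "fps_nth (\<Prod>s=1..M. (1 - fps_X ^ (l * s)) ^ (m + 1) :: complex fps) 0 = 1" for M
      using l by (induction M) (simp_all add: fps_nth_power_0 power_0_left)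
    then show "fps_nth ?E 0 = 1" .
  next
    fix N' assume N': "N' \<le> n" "?P N'"
    have "N' \<noteq> tri j" for j
    proof
      assume "N' = tri j"
      then have "8 * int N' + 1 = (2 * j + 1)\<^sup>2"
        using of_nat_tri[of j] by (simp add: power2_eq_square algebra_simps)
      then have "QuadRes (int l) (8 * int N' + 1)"
        unfolding QuadRes_def by (intro exI[of _ "2 * j + 1"]) simp
      then show False
        using N' by simp
    qed
    then show "fps_nth (?E * crank_trunc l k x n) N' = 0"
      unfolding crank_trunc_root_of_unity[OF assms(1-5)]
      using x0 x2 N' by (intro jacobi_coeff_eq_0) auto
  next
    fix N' i :: nat assume i: "i \<le> N'" "l dvd i" "?P N'"
    then have "[8 * int (N' - i) + 1 = 8 * int N' + 1] (mod int l)"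
      by (auto simp: cong_iff_dvd_diff of_nat_diff)
    then show "?P (N' - i)"
      using i QuadRes_cong by blast
  qed (use nonres False in \<open>auto simp: n_def\<close>)
  then show ?thesis
    using crank_trunc_nth[OF x0, of n n l k] False by (simp add: n_def)
qed (simp add: crank_coeff_negative)

theorem theorem1p1:
  fixes l m k :: nat
  assumes "prime l" and "odd l" and "k = l * m + (l - 1)"
  shows "(\<forall>\<tau>. Im \<tau> > 0 \<longrightarrow>
            (\<lambda>n. of_nat (pkj k 2 (int n)) * e2pi \<tau> ^ n) sums crank_C l m 0 \<tau>) \<and>
         (\<exists>!c. is_q_expansion l m c) \<and>
         (\<forall>c. is_q_expansion l m c \<longrightarrow>
            (\<forall>N. laurent_eval (c N) 1 = of_nat (pkj k 2 N)) \<and>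
            (\<forall>(\<delta>::int) (n::nat). \<not> QuadRes (int l) (8 * \<delta> + 1) \<longrightarrow>
               laurent_of_poly (cyclotomic l) dvd c (int l * int n + \<delta>) \<and>
               laurent_eval (c (int l * int n + \<delta>)) (cis (2 * pi / real l)) = 0)) \<and>
         (\<forall>(\<delta>::int) (n::nat). \<not> QuadRes (int l) (8 * \<delta> + 1) \<longrightarrow>
            [pkj k 2 (int l * int n + \<delta>) = 0] (mod l))"
proof -
  have l: "l \<ge> 3"
    using assms(1,2) prime_ge_2_nat[of l] by (cases "l = 2") auto
  let ?c = "crank_coeff l k"
  have exp: "is_q_expansion l m ?c"
    using assms l by (intro is_q_expansion_crank_coeff)
  have unique: "c = ?c" if "is_q_expansion l m c" for c
    using that exp by (rule is_q_expansion_unique)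
  have part1: "(\<lambda>n. of_nat (pkj k 2 (int n)) * e2pi \<tau> ^ n) sums crank_C l m 0 \<tau>" if "Im \<tau> > 0" for \<tau>
  proof -
    \<comment> \<open>At \<open>z = 0\<close> the region of the expansion is the whole upper half
      plane, and \<zeta> becomes 1.\<close>
    have "real (l - 2) * \<bar>Im 0\<bar> < Im \<tau>"
      using that by simp
    then have "(\<lambda>n. laurent_eval (?c (int n)) (e2pi 0) * e2pi \<tau> ^ n) sums crank_C l m 0 \<tau>"
      using exp unfolding is_q_expansion_def by blast
    then show ?thesis
      by (simp add: e2pi_def laurent_eval_crank_coeff_1)
  qed
  have vanish: "laurent_eval (?c (int l * int n + \<delta>)) x = 0"
    if "\<not> QuadRes (int l) (8 * \<delta> + 1)" "x ^ l = 1" "x \<noteq> 1" for \<delta> n x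
  proof (rule crank_coeff_vanishes[OF assms that(2,3)])
    have "[8 * (int l * int n + \<delta>) + 1 = 8 * \<delta> + 1] (mod int l)"
      by (simp add: cong_iff_dvd_diff)
    then show "\<not> QuadRes (int l) (8 * (int l * int n + \<delta>) + 1)"
      using that(1) QuadRes_cong by blast
  qed
  have dvd: "laurent_of_poly (cyclotomic l) dvd ?c (int l * int n + \<delta>)"
    if "\<not> QuadRes (int l) (8 * \<delta> + 1)" for \<delta> n
    using vanish[OF that] by (intro cyclotomic_dvd_laurent assms(1))
  have zero: "laurent_eval (?c (int l * int n + \<delta>)) (cis (2 * pi / real l)) = 0"
    if "\<not> QuadRes (int l) (8 * \<delta> + 1)" for \<delta> n
  proof (rule vanish[OF that])
    show "cis (2 * pi / real l) ^ l = 1"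
      using l by (simp add: Complex.DeMoivre)
    show "cis (2 * pi / real l) \<noteq> 1"
    proof
      assume "cis (2 * pi / real l) = 1"
      \<comment> \<open>Both sides are values of the standard parametrisation of the
        \<open>l\<close>-th roots of unity, at the indices 1 and 0, and it is injective.\<close>
      then have "cis (2 * pi * real 1 / real l) = cis (2 * pi * real 0 / real l)"
        by simp
      then show False
        using bij_betw_imp_inj_on[OF Complex.bij_betw_roots_unity[of l]] l
        by (auto dest: inj_onD[of _ _ 1 0])
    qed
  qed
  have cong: "[pkj k 2 (int l * int n + \<delta>) = 0] (mod l)"
    if nonres: "\<not> QuadRes (int l) (8 * \<delta> + 1)" for \<delta> n
  proof -
    let ?N = "int l * int n + \<delta>"
    obtain Q where Q: "?c ?N = laurent_of_poly (cyclotomic l) * Q"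
      using dvd[OF nonres] by (rule dvdE)
    \<comment> \<open>At 1 the quotient takes an integer value and the cyclotomic polynomial the
      value \<open>l\<close>, so divisibility of Laurent polynomials becomes a congruence.\<close>
    obtain a where a: "laurent_eval Q 1 = of_int a"
      using laurent_eval_1_in_Ints by (rule Ints_cases)
    have "complex_of_int (int (pkj k 2 ?N)) = laurent_eval (?c ?N) 1"
      by (simp add: laurent_eval_crank_coeff_1)
    also have "\<dots> = of_int (int l * a)"
      unfolding Q
      by (simp add: laurent_eval_mult laurent_eval_of_poly cyclotomic_prime[OF assms(1)]
          map_poly_of_int_sum_monom poly_sum poly_monom a)
    finally have "int l dvd int (pkj k 2 ?N)"
      by (simp only: of_int_eq_iff) simp
    then show ?thesis
      by (simp add: cong_0_iff)
  qed
  have "\<exists>!c. is_q_expansion l m c"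
    using exp unique by blast
  then show ?thesis
  proof (intro conjI allI impI)
    fix c N assume "is_q_expansion l m c"
    then have c: "c = ?c"
      by (rule unique)
    show "laurent_eval (c N) 1 = of_nat (pkj k 2 N)"
      unfolding c by (rule laurent_eval_crank_coeff_1)
  next
    fix c \<delta> and n :: nat
    assume c: "is_q_expansion l m c" and nonres: "\<not> QuadRes (int l) (8 * \<delta> + 1)"
    note c = unique[OF c]
    show "laurent_of_poly (cyclotomic l) dvd c (int l * int n + \<delta>)"
      unfolding c by (rule dvd[OF nonres])
    show "laurent_eval (c (int l * int n + \<delta>)) (cis (2 * pi / real l)) = 0"
      unfolding c by (rule zero[OF nonres])
  qed (use part1 cong in blast)+
qed

end
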